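(* Let $\Omega\subset\mathbb{R}^n$ be a bounded convex open set, let $q\in[0,n)$, and let $v\in C(\overline{\Omega})$, $v\not\equiv 0$, be a convex non-negative function satisfying $$\det D^2 v\ \ge\ v^{q}\,\chi_{\{v>0\}}\quad\text{in }\Omega$$ in the Aleksandrov sense. Let $\Gamma_{nsc}$ be the non-strictly convex part of the free boundary of $v$ (defined in the context). Then for any convex subset $E\subset\Gamma_{nsc}$, $$\dim E<\frac{n+q}{2}.$$ Furthermore, if there exist a point $x_0\in\overline{E}\cap\partial\Omega$ and constants $C,s>1$ such that $$v(x)\le C|x-x_0|^{s}\quad\text{for all }x\in\partial\Omega,$$ then $$\dim E\le n-\frac{(n-q)s}{2}.$$
   Context: $\chi_A$ is the characteristic function of a set $A$. For a convex function $v$ on $\Omega$, $\det D^2v$ denotes its Monge-Ampère measure, $A\mapsto|\partial v(A)|$ for Borel sets $A\subset\Omega$, where $\partial v$ is the subdifferential and $|\cdot|$ the Lebesgue measure; the inequality $\det D^2v\ge f$ in the Aleksandrov sense means that this measure is at least $f\,dx$. For $v$ as in the claim: $K:=\{x\in\Omega: v(x)=0\}$ is the (convex) coincidence set; $\Gamma:=\Omega\cap\partial K$ is the free boundary in $\Omega$; $\Gamma_{sc}:=\{x\in\Omega: x\text{ is an exposed point of }K\}$, where $x\in K$ is an exposed point of $K$ if some supporting hyperplane of $K$ meets $K$ exactly at $x$; and $\Gamma_{nsc}:=\Gamma\setminus\Gamma_{sc}$. $\dim E$ is the dimension of the convex set $E$ (the dimension of its affine hull). *)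

theory Defs
  imports "HOL-Analysis.Analysis"
begin

definition subdifferential :: "'a::euclidean_space set \<Rightarrow> ('a \<Rightarrow> real) \<Rightarrow> 'a \<Rightarrow> 'a set" where
  "subdifferential \<Omega> v x = {p. \<forall>y\<in>\<Omega>. v x + p \<bullet> (y - x) \<le> v y}"

text \<open>
  Meaningful for Borel \<open>A \<subseteq> \<Omega>\<close>.  The Lebesgue measure (not only its restriction \<open>lborel\<close>
  to Borel sets) is needed here: for convex \<open>v\<close> and Borel \<open>A\<close>, the set \<open>\<partial>v(A)\<close> is
  Lebesgue measurable, but it need not be Borel a priori.
\<close>
definition monge_ampere :: "'a::euclidean_space set \<Rightarrow> ('a \<Rightarrow> real) \<Rightarrow> 'a set \<Rightarrow> ennreal" where
  "monge_ampere \<Omega> v A = emeasure lebesgue (\<Union>x\<in>A. subdifferential \<Omega> v x)"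

text \<open>\<open>det D\<^sup>2 v \<ge> f\<close> in \<open>\<Omega>\<close> in the Aleksandrov sense, for \<open>f \<ge> 0\<close>.\<close>
definition aleksandrov_det_ge :: "'a::euclidean_space set \<Rightarrow> ('a \<Rightarrow> real) \<Rightarrow> ('a \<Rightarrow> real) \<Rightarrow> bool" where
  "aleksandrov_det_ge \<Omega> v f \<longleftrightarrow>
     (\<forall>A\<in>sets borel. A \<subseteq> \<Omega> \<longrightarrow> (\<integral>\<^sup>+x\<in>A. ennreal (f x) \<partial>lborel) \<le> monge_ampere \<Omega> v A)"

definition exposed_point_of :: "'a::euclidean_space \<Rightarrow> 'a set \<Rightarrow> bool"
    (infix \<open>exposed'_point'_of\<close> 50) where
  "x exposed_point_of K \<longleftrightarrow> {x} exposed_face_of K"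

text \<open>
  The library notion allows the degenerate \<open>hyperplane\<close> with normal vector \<open>0\<close>; for singletons
  this makes no difference.
\<close>
lemma exposed_point_of_iff_supporting_hyperplane:
  fixes K :: "'a::euclidean_space set"
  assumes "convex K"
  shows "x exposed_point_of K \<longleftrightarrow>
           (\<exists>a b. a \<noteq> 0 \<and> K \<subseteq> {y. a \<bullet> y \<le> b} \<and> K \<inter> {y. a \<bullet> y = b} = {x})"
proof
  assume "x exposed_point_of K"
  then obtain a b where ab: "K \<subseteq> {y. a \<bullet> y \<le> b}" "{x} = K \<inter> {y. a \<bullet> y = b}"
    unfolding exposed_point_of_def exposed_face_of_def by blast
  show "\<exists>a b. a \<noteq> 0 \<and> K \<subseteq> {y. a \<bullet> y \<le> b} \<and> K \<inter> {y. a \<bullet> y = b} = {x}"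
  proof (cases "a = 0")
    case True
    then have K: "K = {x}" using ab by auto
    obtain e :: 'a where "e \<in> Basis" using nonempty_Basis by blast
    then have "e \<noteq> 0" by auto
    then show ?thesis using K by (intro exI[of _ e] exI[of _ "e \<bullet> x"]) auto
  next
    case False
    then show ?thesis using ab by metis
  qed
next
  assume "\<exists>a b. a \<noteq> 0 \<and> K \<subseteq> {y. a \<bullet> y \<le> b} \<and> K \<inter> {y. a \<bullet> y = b} = {x}"
  then obtain a b where ab: "K \<subseteq> {y. a \<bullet> y \<le> b}" "K \<inter> {y. a \<bullet> y = b} = {x}" by blast
  have "(K \<inter> {y. a \<bullet> y = b}) face_of K"
    using ab(1) by (intro face_of_Int_supporting_hyperplane_le assms) auto
  then show "x exposed_point_of K"
    unfolding exposed_point_of_def exposed_face_of_def using ab by metis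
qed

definition coincidence_set :: "'a::euclidean_space set \<Rightarrow> ('a \<Rightarrow> real) \<Rightarrow> 'a set" where
  "coincidence_set \<Omega> v = {x\<in>\<Omega>. v x = 0}"

definition free_boundary :: "'a::euclidean_space set \<Rightarrow> ('a \<Rightarrow> real) \<Rightarrow> 'a set" where
  "free_boundary \<Omega> v = \<Omega> \<inter> frontier (coincidence_set \<Omega> v)"

definition free_boundary_sc :: "'a::euclidean_space set \<Rightarrow> ('a \<Rightarrow> real) \<Rightarrow> 'a set" where
  "free_boundary_sc \<Omega> v = {x\<in>\<Omega>. x exposed_point_of coincidence_set \<Omega> v}"

definition free_boundary_nsc :: "'a::euclidean_space set \<Rightarrow> ('a \<Rightarrow> real) \<Rightarrow> 'a set" where
  "free_boundary_nsc \<Omega> v = free_boundary \<Omega> v - free_boundary_sc \<Omega> v"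

end

theory Submission
  imports Defs
begin

text \<open>
  Write $n$ for the dimension of the space, $k = \dim E$ and $m = n - k$.

  Suppose $v$ differs from an affine function by a quantity between $0$ and $h$ on a symmetric
  convex body $S$.  At a point of the concentric half body every subgradient, reduced by the slope
  of the affine function, is bounded by a multiple of $h$ in the norm polar to $S$; hence the
  Monge-Ampere measure of the half body is at most $C h^n / |S|$.  On the other hand, if $v = a > 0$
  at the centre, midpoint convexity gives $v \ge a$ on at least half of the half body, so its
  Monge-Ampere measure is at least $c\, a^q |S|$.  Together, $a^q |S|^2 \le C h^n$.  Here $a$ may be
  much smaller than $h$.  Replacing $v$ at the centre by its maxima over the bodies $2^{-j} S$ and
  iterating removes this loss: if $v > 0$ at the centre of $S$ and $v \le h$ on $S$, then
  $|S|^2 \le C h^{n-q}$.  This is the nondegeneracy estimate usually obtained from a comparison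
  principle (lemmas \<open>aleksandrov_box_estimate\<close> and \<open>nondegeneracy\<close>).

  Let $p$ be a point in the relative interior of $E$.  There $v$ vanishes in $k$ directions, and
  $p$ is a limit of points with $v > 0$.  If $v \le h$ up to distance $\rho$ from $p$ in the $m$
  transverse directions, then by convexity $v \le h$ on a body of volume about $\rho^m$, so that
  $\rho^{2m} \le C h^{n-q}$ (lemma \<open>slab_growth\<close>).

  If $v \le C|x - x_0|^s$ on $\partial\Omega$, the same growth holds at $p$: a ray from a point of
  $E$ beyond $p$, passing at distance $\rho$ from $p$, leaves $\Omega$ at distance $O(\rho)$ from
  $x_0$, and $v$ is nondecreasing along it
  (lemma \<open>boundary_growth_propagates\<close>).  Taking $h = C\rho^s$ yields $2m \ge (n-q)s$, which is the
  second claim.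

  For the first claim suppose $2m \le n - q$.  If $v$ were $o(\rho)$ along every transverse
  coordinate direction, $h = \epsilon\rho$ would contradict \<open>slab_growth\<close>.  So some
  transverse direction has a positive slope $a$.  Around the point at distance $t$ in this
  direction take a box of fixed size along $E$, of size $t$ in this direction and of size
  $\epsilon t$ in the remaining ones.  Subtracting the linear function of slope $a$ in this direction
  leaves an oscillation of only $O(\epsilon t)$ on the box, while $v \ge a t$ at its centre.  The
  first estimate then reads $(at)^q |S|^2 \le C (\epsilon t)^n$, which fails as $\epsilon \to 0$
  (lemma \<open>linear_direction_impossible\<close>).

  One linear change of variables adapted to $E$ turns all these bodies into coordinate boxes; it
  multiplies all volumes by the same positive factor.
\<close>

section \<open>Linear maps scale Lebesgue measure\<close>

text \<open>
  Both $A \mapsto |g^{-1}(A)|$ and Lebesgue measure are translation invariant, and two such measures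
  are proportional: by Fubini $|g^{-1}(A)|\,|B| = |g^{-1}(B)|\,|A|$ for all Borel sets
  $A$, $B$.  Taking for $B$ the unit ball gives the factor, which is $1/|\det g|$.
\<close>

lemma emeasure_linear_vimage:
  fixes g :: "'a::euclidean_space \<Rightarrow> 'a"
  assumes g: "linear g" "bij g"
  obtains \<kappa> where "\<kappa> > 0"
    "\<And>A. A \<in> sets borel \<Longrightarrow> emeasure lborel (g -` A) = ennreal \<kappa> * emeasure lborel A"
proof -
  define g' where "g' = inv g"
  have g': "linear g'" and gg': "\<And>x. g (g' x) = x" and g'g: "\<And>x. g' (g x) = x"
    using g unfolding g'_def
    by (auto simp: bij_def surj_f_inv_f inj_linear_imp_inv_linear)
  have g_meas [measurable]: "g \<in> borel_measurable borel" "g' \<in> borel_measurable borel"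
    using g(1) g' by (auto intro!: borel_measurable_continuous_onI linear_continuous_on
        simp: linear_conv_bounded_linear)
  have shift: "(\<integral>\<^sup>+x. f (t + x) \<partial>lborel) = (\<integral>\<^sup>+x. f x \<partial>lborel)"
    if "f \<in> borel_measurable borel" for f :: "'a \<Rightarrow> ennreal" and t
  proof -
    have "(\<integral>\<^sup>+x. f x \<partial>lborel) = (\<integral>\<^sup>+x. f x \<partial>distr lborel borel ((+) t))"
      by (simp add: lborel_distr_plus)
    also have "\<dots> = (\<integral>\<^sup>+x. f (t + x) \<partial>lborel)"
      using that by (subst nn_integral_distr) auto
    finally show ?thesis by simp
  qed
  have refl: "(\<integral>\<^sup>+x. f (- x) \<partial>lborel) = (\<integral>\<^sup>+x. f x \<partial>lborel)"
    if "f \<in> borel_measurable borel" for f :: "'a \<Rightarrow> ennreal"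
  proof -
    have "(\<integral>\<^sup>+x. f x \<partial>lborel) = (\<integral>\<^sup>+x. f x \<partial>distr lborel borel uminus)"
      using lborel_affine[of "-1" "0::'a"] by (simp add: density_1 fun_Compl_def)
    also have "\<dots> = (\<integral>\<^sup>+x. f (- x) \<partial>lborel)"
      using that by (subst nn_integral_distr) auto
    finally show ?thesis by simp
  qed
  have vimage: "g -` A \<in> sets borel" if "A \<in> sets borel" for A
    using measurable_sets[OF g_meas(1) that] by simp
  have swap: "emeasure lborel (g -` A) * emeasure lborel B = emeasure lborel (g -` B) * emeasure lborel A"
    if [measurable]: "A \<in> sets borel" "B \<in> sets borel" for A B
  proof -
    let ?a = "indicator A :: 'a \<Rightarrow> ennreal" and ?b = "indicator B :: 'a \<Rightarrow> ennreal"
    have int: "(\<integral>\<^sup>+x. indicator X (g x) \<partial>lborel) = emeasure lborel (g -` X)" if "X \<in> sets borel" for X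
      using nn_integral_indicator[of "g -` X" lborel] vimage[OF that]
      by (simp add: indicator_vimage comp_def)
    \<comment> \<open>Integrate the product of the indicators of A at g x and of B at g x + y;
        shifting either variable and reflecting y exchanges the two sets.\<close>
    have "emeasure lborel (g -` A) * emeasure lborel B = (\<integral>\<^sup>+x. ?a (g x) * (\<integral>\<^sup>+y. ?b y \<partial>lborel) \<partial>lborel)"
      by (simp add: nn_integral_multc int)
    also have "\<dots> = (\<integral>\<^sup>+x. ?a (g x) * (\<integral>\<^sup>+y. ?b (g x + y) \<partial>lborel) \<partial>lborel)"
      using shift[of ?b] by simp
    also have "\<dots> = (\<integral>\<^sup>+x. \<integral>\<^sup>+y. ?a (g x) * ?b (g x + y) \<partial>lborel \<partial>lborel)"
      by (simp add: nn_integral_cmult)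
    also have "\<dots> = (\<integral>\<^sup>+y. \<integral>\<^sup>+x. ?a (g x) * ?b (g x + y) \<partial>lborel \<partial>lborel)"
      by (rule lborel_pair.Fubini'[symmetric]) measurable
    also have "\<dots> = (\<integral>\<^sup>+y. \<integral>\<^sup>+x. ?a (g (- g' y + x)) * ?b (g (- g' y + x) + y) \<partial>lborel \<partial>lborel)"
    proof (rule nn_integral_cong)
      fix y
      show "(\<integral>\<^sup>+x. ?a (g x) * ?b (g x + y) \<partial>lborel)
          = (\<integral>\<^sup>+x. ?a (g (- g' y + x)) * ?b (g (- g' y + x) + y) \<partial>lborel)"
        by (rule shift[of "\<lambda>x. ?a (g x) * ?b (g x + y)" "- g' y", symmetric]) measurable
    qed
    also have "\<dots> = (\<integral>\<^sup>+y. \<integral>\<^sup>+x. ?a (g x - y) * ?b (g x) \<partial>lborel \<partial>lborel)"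
      by (simp add: linear_diff[OF g(1)] gg')
    also have "\<dots> = (\<integral>\<^sup>+x. \<integral>\<^sup>+y. ?a (g x - y) * ?b (g x) \<partial>lborel \<partial>lborel)"
      by (rule lborel_pair.Fubini') measurable
    also have "\<dots> = (\<integral>\<^sup>+x. (\<integral>\<^sup>+y. ?a (g x + - y) \<partial>lborel) * ?b (g x) \<partial>lborel)"
      by (simp add: nn_integral_multc)
    also have "\<dots> = (\<integral>\<^sup>+x. (\<integral>\<^sup>+y. ?a (g x + y) \<partial>lborel) * ?b (g x) \<partial>lborel)"
      using refl[of "\<lambda>y. ?a (g x + y)" for x] by simp
    also have "\<dots> = (\<integral>\<^sup>+x. (\<integral>\<^sup>+y. ?a y \<partial>lborel) * ?b (g x) \<partial>lborel)"
      using shift[of ?a] by simp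
    also have "\<dots> = emeasure lborel (g -` B) * emeasure lborel A"
      by (simp add: nn_integral_cmult int mult.commute)
    finally show ?thesis .
  qed
  define B where "B = (cball 0 1 :: 'a set)"
  have pos: "0 < measure lborel S" if S: "compact S" "interior S \<noteq> {}" for S :: "'a set"
  proof -
    obtain x e where e: "0 < e" "ball x e \<subseteq> S"
      using S(2) by (meson all_not_in_conv mem_interior)
    have "0 < measure lborel (ball x e)"
      using e content_ball_pos[of e x] by simp
    also have "\<dots> \<le> measure lborel S"
      using e S(1) by (intro measure_mono_fmeasurable) (auto simp: fmeasurable_compact)
    finally show ?thesis .
  qed
  have vB: "g -` B = g' ` B" unfolding g'_def by (rule bij_vimage_eq_inv_image[OF g(2)])
  have cont: "continuous_on UNIV g'" "continuous_on UNIV g"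
    using g(1) g' by (auto intro!: linear_continuous_on simp: linear_conv_bounded_linear)
  have "compact (g' ` B)"
    by (intro compact_continuous_image continuous_on_subset[OF cont(1)]) (auto simp: B_def)
  then have cvB: "compact (g -` B)" by (simp only: vB)
  have "open (g -` ball 0 1)" by (intro open_vimage cont(2)) auto
  then have "g -` ball 0 1 \<subseteq> interior (g -` B)"
    by (intro interior_maximal) (auto simp: B_def)
  moreover have "0 \<in> g -` ball 0 1" using linear_0[OF g(1)] by simp
  ultimately have 1: "0 < measure lborel (g -` B)" by (intro pos cvB) auto
  have 2: "0 < measure lborel B" unfolding B_def by (intro pos) auto
  have fin: "emeasure lborel S = ennreal (measure lborel S)" if "compact S" for S :: "'a set"
    using fmeasurable_compact[OF that] unfolding fmeasurable_def
    by (intro emeasure_eq_ennreal_measure) auto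
  have fin_B: "emeasure lborel B = ennreal (measure lborel B)"
    by (rule fin) (simp add: B_def)
  have B_borel: "B \<in> sets borel" by (simp add: B_def)
  have "emeasure lborel (g -` A) = ennreal (measure lborel (g -` B) / measure lborel B) * emeasure lborel A"
    if "A \<in> sets borel" for A
  proof -
    have "ennreal (measure lborel B) * emeasure lborel (g -` A)
        = ennreal (measure lborel (g -` B)) * emeasure lborel A"
      using swap[OF that B_borel] by (simp only: fin_B fin[OF cvB] mult.commute)
    also have "ennreal (measure lborel (g -` B))
        = ennreal (measure lborel B) * ennreal (measure lborel (g -` B) / measure lborel B)"
      using 2 by (subst ennreal_mult'[symmetric]) auto
    finally have "ennreal (measure lborel B) * emeasure lborel (g -` A) = ennreal (measure lborel B) *
        (ennreal (measure lborel (g -` B) / measure lborel B) * emeasure lborel A)"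
      by (simp only: mult.assoc)
    then show ?thesis
      using 2 by (subst (asm) ennreal_mult_cancel_left) auto
  qed
  moreover have "0 < measure lborel (g -` B) / measure lborel B"
    using 1 2 by simp
  ultimately show thesis by (rule that[rotated])
qed

section \<open>The Monge-Ampere estimate on boxes\<close>

text \<open>
  In normalized coordinates the body is the box with centre $a$ and half side lengths $r \cdot b$,
  the affine function is $x \mapsto \eta \cdot x + \alpha$, and $D$ absorbs the distortion of volume
  by the change of variables.
\<close>

definition box_estimate :: "real \<Rightarrow> real \<Rightarrow> ('a::euclidean_space \<Rightarrow> real) \<Rightarrow> bool" where
  "box_estimate D q \<phi> \<longleftrightarrow>
     (\<forall>a r \<eta> \<alpha> h. (\<forall>b\<in>Basis. 0 < r \<bullet> b) \<longrightarrow> cbox (a - r) (a + r) \<subseteq> cbox (- One) One \<longrightarrow> 0 < \<phi> a \<longrightarrow>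
        (\<forall>x\<in>cbox (a - r) (a + r). 0 \<le> \<phi> x - \<eta> \<bullet> x - \<alpha> \<and> \<phi> x - \<eta> \<bullet> x - \<alpha> \<le> h) \<longrightarrow>
        \<phi> a powr q * D * (\<Prod>b\<in>Basis. r \<bullet> b)\<^sup>2 \<le> 2 * (4 * h) ^ DIM('a))"

lemma convex_on_affine_precompose:
  assumes f: "convex_on S' f" and T: "linear T" and S: "convex S" "(\<lambda>x. p + T x) ` S \<subseteq> S'"
  shows "convex_on S (\<lambda>x. f (p + T x))"
proof (rule convex_onI)
  fix t x y assume t: "0 < t" "t < (1::real)" and xy: "x \<in> S" "y \<in> S"
  have "p + T ((1 - t) *\<^sub>R x + t *\<^sub>R y) = (1 - t) *\<^sub>R (p + T x) + t *\<^sub>R (p + T y)"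
    using T by (simp only: linear_add linear_scale) (simp add: algebra_simps)
  then show "f (p + T ((1 - t) *\<^sub>R x + t *\<^sub>R y)) \<le> (1 - t) * f (p + T x) + t * f (p + T y)"
    using convex_onD[OF f, of t "p + T x" "p + T y"] t xy S(2) by auto
qed (use S in simp)

text \<open>
  The reflection $x \mapsto 2a - x$ preserves the box and its volume, and by midpoint convexity at
  least one of a point and its reflection lies in the superlevel set.
\<close>

lemma half_box_superlevel:
  fixes \<phi> :: "'a::euclidean_space \<Rightarrow> real"
  assumes conv: "convex_on (cbox (a - s) (a + s)) \<phi>"
    and cont: "continuous_on (cbox (a - s) (a + s)) \<phi>"
    and s: "\<And>b. b \<in> Basis \<Longrightarrow> 0 \<le> s \<bullet> b"
  defines "H \<equiv> {x \<in> cbox (a - s) (a + s). \<phi> a \<le> \<phi> x}"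
  shows "compact H" "ennreal (\<Prod>b\<in>Basis. 2 * (s \<bullet> b)) \<le> 2 * emeasure lborel H"
proof -
  let ?A = "cbox (a - s) (a + s)"
  have "H = ?A \<inter> \<phi> -` {\<phi> a..}" by (auto simp: H_def)
  moreover have "closed (?A \<inter> \<phi> -` {\<phi> a..})"
    by (intro continuous_closed_preimage[OF cont]) auto
  ultimately have "closed H" by simp
  then show H: "compact H"
    unfolding compact_eq_bounded_closed
    by (auto simp: H_def intro: bounded_subset[OF bounded_cbox, of _ "a - s" "a + s"])
  have H_borel: "H \<in> sets borel" using H by (simp add: borel_compact)
  define R where "R x = 2 *\<^sub>R a - x" for x
  have "?A \<subseteq> H \<union> R -` H"
  proof
    fix x assume x: "x \<in> ?A"
    then have Rx: "R x \<in> ?A" by (auto simp: R_def mem_box algebra_simps)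
    have "a = (1/2) *\<^sub>R x + (1/2) *\<^sub>R R x" by (simp add: R_def algebra_simps)
    then have "\<phi> a \<le> (1/2) * \<phi> x + (1/2) * \<phi> (R x)"
      using convex_onD[OF conv, of "1/2" x "R x"] x Rx by simp
    then have "\<phi> a \<le> \<phi> x \<or> \<phi> a \<le> \<phi> (R x)" by linarith
    then show "x \<in> H \<union> R -` H" using x Rx by (auto simp: H_def)
  qed
  moreover have RH: "R -` H \<in> sets borel"
  proof -
    have "R \<in> borel_measurable borel" unfolding R_def by measurable
    from measurable_sets[OF this H_borel] show ?thesis by simp
  qed
  ultimately have "emeasure lborel ?A \<le> emeasure lborel (H \<union> R -` H)"
    using H_borel by (intro emeasure_mono) auto
  also have "\<dots> \<le> emeasure lborel H + emeasure lborel (R -` H)"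
    using H_borel RH by (intro emeasure_subadditive) auto
  also have "emeasure lborel (R -` H) = emeasure lborel H"
  proof -
    have "lborel = distr lborel borel R"
      using lborel_affine[of "-1" "2 *\<^sub>R a"] by (simp add: density_1 R_def[abs_def])
    then have "emeasure lborel H = emeasure (distr lborel borel R) H" by simp
    also have "\<dots> = emeasure lborel (R -` H)"
      using H_borel by (subst emeasure_distr) (auto simp: R_def[abs_def])
    finally show ?thesis by simp
  qed
  finally have "emeasure lborel ?A \<le> 2 * emeasure lborel H" by (simp add: mult_2)
  moreover have "emeasure lborel ?A = ennreal (\<Prod>b\<in>Basis. 2 * (s \<bullet> b))"
    using s by (subst emeasure_lborel_cbox) (auto simp: algebra_simps)
  ultimately show "ennreal (\<Prod>b\<in>Basis. 2 * (s \<bullet> b)) \<le> 2 * emeasure lborel H" by simp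
qed

text \<open>
  The estimate compares two bounds for the Monge-Ampere measure of the superlevel set
  $\{v \ge \phi(a)\}$ in the half box.  From below it is $\phi(a)^q$ times the volume of that set.
  From above, a subgradient at a point $x$ of the half box is tested against
  $x \pm \frac12 (r \cdot b) b$, which still lie in the full box: each of its coordinates, pulled back by
  the adjoint of $T$, lies within $2h/(r \cdot b)$ of that of $\eta$.
\<close>

lemma aleksandrov_box_estimate:
  fixes v :: "'a::euclidean_space \<Rightarrow> real" and T :: "'a \<Rightarrow> 'a"
  assumes "aleksandrov_det_ge \<Omega> v (\<lambda>x. v x powr q * indicator {x. v x > 0} x)"
    and "0 \<le> q" and cont: "continuous_on \<Omega> v" and conv: "convex_on \<Omega> v"
    and T: "linear T" "bij T"
    and cube: "\<And>x. x \<in> cbox (- One) One \<Longrightarrow> p + T x \<in> \<Omega>"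
  obtains D where "D > 0" "box_estimate D q (\<lambda>x. v (p + T x))"
proof -
  let ?n = "DIM('a)"
  define \<phi> where "\<phi> x = v (p + T x)" for x
  have T_cont: "continuous_on S (\<lambda>x. p + T x)" for S
    using T(1) by (intro continuous_on_add continuous_on_const linear_continuous_on)
      (simp add: linear_conv_bounded_linear)
  have linv: "linear (inv T)" and binv: "bij (inv T)"
    using T by (auto simp: bij_def inj_linear_imp_inv_linear bij_imp_bij_inv inj_imp_surj_inv surj_imp_inj_inv)
  obtain \<kappa>1 where k1: "\<kappa>1 > 0"
    "\<And>A. A \<in> sets borel \<Longrightarrow> emeasure lborel (inv T -` A) = ennreal \<kappa>1 * emeasure lborel A"
    using emeasure_linear_vimage[OF linv binv] by blast
  have "inj (adjoint T)"
  proof (rule linear_injective_0[THEN iffD2, rule_format, OF adjoint_linear[OF T(1)]])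
    fix x assume "adjoint T x = 0"
    then have "x \<bullet> T y = 0" for y using adjoint_works[OF T(1), of y x] by (simp add: inner_commute)
    then show "x = 0" using T(2) by (metis bij_def inner_eq_zero_iff surjD)
  qed
  then have "bij (adjoint T)"
    by (simp add: bij_def linear_injective_imp_surjective adjoint_linear T(1))
  then obtain \<kappa>2 where k2: "\<kappa>2 > 0"
    "\<And>A. A \<in> sets borel \<Longrightarrow> emeasure lborel (adjoint T -` A) = ennreal \<kappa>2 * emeasure lborel A"
    using emeasure_linear_vimage[OF adjoint_linear[OF T(1)]] by blast
  have "box_estimate (\<kappa>1 / \<kappa>2) q \<phi>"
    unfolding box_estimate_def
  proof (intro allI impI)
    fix a r \<eta> \<alpha> h
    assume r: "\<forall>b\<in>Basis. 0 < r \<bullet> b" and sub: "cbox (a - r) (a + r) \<subseteq> cbox (- One) One"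
      and pos: "0 < \<phi> a"
      and osc: "\<forall>x\<in>cbox (a - r) (a + r). 0 \<le> \<phi> x - \<eta> \<bullet> x - \<alpha> \<and> \<phi> x - \<eta> \<bullet> x - \<alpha> \<le> h"
    define s where "s = (1/2) *\<^sub>R r"
    let ?A = "cbox (a - s) (a + s)"
    have AB: "?A \<subseteq> cbox (a - r) (a + r)"
      using r by (force simp: mem_box s_def algebra_simps)
    have im: "(\<lambda>x. p + T x) ` ?A \<subseteq> \<Omega>" using AB sub cube by blast
    have \<phi>_conv: "convex_on ?A \<phi>"
      unfolding \<phi>_def using im by (intro convex_on_affine_precompose[OF conv T(1)]) auto
    have \<phi>_cont: "continuous_on ?A \<phi>"
      unfolding \<phi>_def using continuous_on_compose2[OF cont T_cont im] .
    have s0: "0 \<le> s \<bullet> b" if "b \<in> Basis" for b using r that by (simp add: s_def less_imp_le)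
    define H where "H = {x \<in> ?A. \<phi> a \<le> \<phi> x}"
    note H = H_def half_box_superlevel[OF \<phi>_conv \<phi>_cont s0, folded H_def]
    define P where "P = (\<Prod>b\<in>Basis. r \<bullet> b)"
    have P: "P > 0" "ennreal P \<le> 2 * emeasure lborel H"
      using H(3) r by (auto simp: s_def P_def intro: prod_pos)
    define H' where "H' = (\<lambda>x. p + T x) ` H"
    have H': "compact H'" "H' \<subseteq> \<Omega>" "H' \<in> sets borel"
      unfolding H'_def using H im
      by (auto intro!: compact_continuous_image T_cont borel_compact)
    have eH': "emeasure lborel H' = ennreal \<kappa>1 * emeasure lborel H"
    proof -
      have "inv T -` H = T ` H" using T(2) by (simp add: bij_vimage_eq_inv_image binv inv_inv_eq)
      then have "H' = (+) p ` (inv T -` H)" by (auto simp: H'_def)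
      moreover have "inv T -` H \<in> sets borel"
        using \<open>inv T -` H = T ` H\<close> T(1) compact_continuous_image[OF linear_continuous_on H(2), of T]
        by (simp add: borel_compact linear_conv_bounded_linear)
      moreover have "emeasure lborel ((+) p ` X) = emeasure lborel X" if "X \<in> sets borel" for X
      proof -
        have "(+) p ` X = (+) (- p) -` X" by (auto simp: image_iff) (metis add.commute diff_add_cancel)
        moreover have "emeasure lborel X = emeasure (distr lborel borel ((+) (- p))) X"
          by (simp only: lborel_distr_plus)
        ultimately show ?thesis using that by (simp add: emeasure_distr)
      qed
      ultimately show ?thesis using k1(2)[of H] H(2) by (simp add: borel_compact)
    qed
    have h: "h \<ge> 0"
    proof -
      have "a \<in> cbox (a - r) (a + r)" using r by (auto simp: mem_box algebra_simps less_imp_le)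
      then show ?thesis using osc by force
    qed
    define G where "G = (\<Union>x\<in>H'. subdifferential \<Omega> v x)"
    define g where "g = (\<Sum>b\<in>Basis. (2 * h / (r \<bullet> b)) *\<^sub>R b)"
    have g: "g \<bullet> b = 2 * h / (r \<bullet> b)" if "b \<in> Basis" for b using that by (simp add: g_def)
    have "G \<subseteq> adjoint T -` cbox (\<eta> - g) (\<eta> + g)"
    proof
      fix \<xi> assume "\<xi> \<in> G"
      then obtain x where x: "x \<in> ?A" and xi: "\<xi> \<in> subdifferential \<Omega> v (p + T x)"
        by (auto simp: G_def H'_def H(1))
      \<comment> \<open>The affine part cancels, so only the oscillation h of the remainder enters.\<close>
      have key: "(adjoint T \<xi> - \<eta>) \<bullet> (y - x) \<le> h" if "y \<in> cbox (a - r) (a + r)" for y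
      proof -
        have "v (p + T x) + \<xi> \<bullet> ((p + T y) - (p + T x)) \<le> v (p + T y)"
          using xi that sub cube unfolding subdifferential_def by blast
        then have "adjoint T \<xi> \<bullet> (y - x) \<le> \<phi> y - \<phi> x"
          using adjoint_works[OF T(1), of "y - x" \<xi>]
          by (simp add: \<phi>_def linear_diff[OF T(1)] inner_commute)
        moreover have "0 \<le> \<phi> x - \<eta> \<bullet> x - \<alpha>" "\<phi> y - \<eta> \<bullet> y - \<alpha> \<le> h"
          using osc that x AB by auto
        ultimately show ?thesis
          unfolding inner_diff_left inner_diff_right by linarith
      qed
      have "\<bar>(adjoint T \<xi> - \<eta>) \<bullet> b\<bar> \<le> g \<bullet> b" if b: "b \<in> Basis" for b
      proof -
        have rb: "r \<bullet> b > 0" using r b by blast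
        have mem: "x + c *\<^sub>R b \<in> cbox (a - r) (a + r)" if c: "\<bar>c\<bar> \<le> r \<bullet> b / 2" for c
          unfolding mem_box
        proof
          fix j :: 'a assume j: "j \<in> Basis"
          have "\<bar>(x - a) \<bullet> j\<bar> \<le> r \<bullet> j / 2"
          proof -
            have "(a - s) \<bullet> j \<le> x \<bullet> j" "x \<bullet> j \<le> (a + s) \<bullet> j"
              using x j unfolding mem_box by blast+
            then have "- (r \<bullet> j / 2) \<le> x \<bullet> j - a \<bullet> j" "x \<bullet> j - a \<bullet> j \<le> r \<bullet> j / 2"
              by (simp_all add: s_def inner_diff_left inner_add_left)
            then show ?thesis unfolding inner_diff_left abs_le_iff by linarith
          qed
          moreover have "\<bar>(c *\<^sub>R b) \<bullet> j\<bar> \<le> r \<bullet> j / 2"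
            using c b j r by (auto simp: inner_Basis less_imp_le)
          ultimately show "(a - r) \<bullet> j \<le> (x + c *\<^sub>R b) \<bullet> j \<and> (x + c *\<^sub>R b) \<bullet> j \<le> (a + r) \<bullet> j"
            unfolding inner_add_left inner_diff_left abs_le_iff by linarith
        qed
        have "(r \<bullet> b / 2) * ((adjoint T \<xi> - \<eta>) \<bullet> b) \<le> h" "- (r \<bullet> b / 2) * ((adjoint T \<xi> - \<eta>) \<bullet> b) \<le> h"
          using key[OF mem, of "r \<bullet> b / 2"] key[OF mem, of "- (r \<bullet> b / 2)"] rb by auto
        then show ?thesis
          unfolding g[OF b] abs_le_iff pos_le_divide_eq[OF rb] by (simp add: mult.commute)
      qed
      then show "\<xi> \<in> adjoint T -` cbox (\<eta> - g) (\<eta> + g)"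
        by (force simp: mem_box algebra_simps abs_le_iff)
    qed
    moreover have adj_borel: "adjoint T -` cbox (\<eta> - g) (\<eta> + g) \<in> sets borel"
    proof -
      have "adjoint T \<in> borel_measurable borel"
        using adjoint_linear[OF T(1)] by (auto intro!: borel_measurable_continuous_onI
            linear_continuous_on simp: linear_conv_bounded_linear)
      from measurable_sets[OF this, of "cbox (\<eta> - g) (\<eta> + g)"] show ?thesis by simp
    qed
    ultimately have "emeasure lebesgue G \<le> emeasure lebesgue (adjoint T -` cbox (\<eta> - g) (\<eta> + g))"
      by (intro emeasure_mono) auto
    also have "\<dots> = ennreal \<kappa>2 * emeasure lborel (cbox (\<eta> - g) (\<eta> + g))"
      using adj_borel k2(2)[of "cbox (\<eta> - g) (\<eta> + g)"] by (simp add: emeasure_lborel_cbox_eq)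
    also have "emeasure lborel (cbox (\<eta> - g) (\<eta> + g)) = ennreal (\<Prod>b\<in>Basis. 4 * h / (r \<bullet> b))"
      using g h r by (subst emeasure_lborel_cbox)
        (auto simp: algebra_simps less_imp_le intro!: prod.cong arg_cong[where f=ennreal])
    also have "(\<Prod>b\<in>Basis. 4 * h / (r \<bullet> b)) = (4 * h) ^ ?n / P"
      by (simp add: P_def prod_dividef)
    finally have up: "emeasure lebesgue G \<le> ennreal (\<kappa>2 * ((4 * h) ^ ?n / P))"
      using k2(1) by (subst ennreal_mult') auto
    have "ennreal (\<phi> a powr q) * emeasure lborel H' = (\<integral>\<^sup>+x. ennreal (\<phi> a powr q) * indicator H' x \<partial>lborel)"
      using H'(3) by (simp add: nn_integral_cmult_indicator)
    also have "\<dots> \<le> (\<integral>\<^sup>+x\<in>H'. ennreal (v x powr q * indicator {x. v x > 0} x) \<partial>lborel)"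
    proof (intro nn_integral_mono)
      fix x
      show "ennreal (\<phi> a powr q) * indicator H' x \<le> ennreal (v x powr q * indicator {x. v x > 0} x) * indicator H' x"
      proof (cases "x \<in> H'")
        case True
        then have "\<phi> a \<le> v x" by (auto simp: H'_def H(1) \<phi>_def)
        then have "\<phi> a powr q \<le> v x powr q" using pos \<open>0 \<le> q\<close> by (intro powr_mono2) auto
        then show ?thesis using True pos \<open>\<phi> a \<le> v x\<close> by (simp add: ennreal_leI)
      qed simp
    qed
    also have "\<dots> \<le> emeasure lebesgue G"
      using assms(1)[unfolded aleksandrov_det_ge_def monge_ampere_def, rule_format, OF H'(3,2)]
      by (simp only: G_def)
    finally have "ennreal (\<phi> a powr q) * (ennreal \<kappa>1 * emeasure lborel H) \<le> ennreal (\<kappa>2 * ((4 * h) ^ ?n / P))"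
      using up unfolding eH' by (rule order_trans)
    then have "2 * (ennreal (\<phi> a powr q) * (ennreal \<kappa>1 * emeasure lborel H)) \<le> 2 * ennreal (\<kappa>2 * ((4 * h) ^ ?n / P))"
      by (rule mult_left_mono) simp
    moreover have "ennreal (\<phi> a powr q * \<kappa>1 * P) \<le> 2 * (ennreal (\<phi> a powr q) * (ennreal \<kappa>1 * emeasure lborel H))"
    proof -
      have "ennreal (\<phi> a powr q * \<kappa>1 * P) = ennreal (\<phi> a powr q * \<kappa>1) * ennreal P"
        using P(1) k1(1) by (simp add: ennreal_mult)
      also have "\<dots> \<le> ennreal (\<phi> a powr q * \<kappa>1) * (2 * emeasure lborel H)"
        using P(2) by (rule mult_left_mono) simp
      finally show ?thesis using k1(1) by (simp add: ennreal_mult ac_simps)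
    qed
    moreover have "2 * ennreal (\<kappa>2 * ((4 * h) ^ ?n / P)) = ennreal (2 * (\<kappa>2 * ((4 * h) ^ ?n / P)))"
      using k2(1) h P(1) by (subst ennreal_mult) auto
    ultimately have "ennreal (\<phi> a powr q * \<kappa>1 * P) \<le> ennreal (2 * (\<kappa>2 * ((4 * h) ^ ?n / P)))"
      by order
    then have bnd: "\<phi> a powr q * \<kappa>1 * P \<le> 2 * (\<kappa>2 * ((4 * h) ^ ?n / P))"
      using k2(1) h P(1) by (subst (asm) ennreal_le_iff) auto
    show "\<phi> a powr q * (\<kappa>1 / \<kappa>2) * (\<Prod>b\<in>Basis. r \<bullet> b)\<^sup>2 \<le> 2 * (4 * h) ^ ?n"
    proof -
      let ?c = "2 * (4 * h) ^ ?n"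
      have "\<phi> a powr q * (\<kappa>1 / \<kappa>2) * P\<^sup>2 = (\<phi> a powr q * \<kappa>1 * P) * (P / \<kappa>2)"
        by (simp add: power2_eq_square)
      also have "\<dots> \<le> 2 * (\<kappa>2 * ((4 * h) ^ ?n / P)) * (P / \<kappa>2)"
        using bnd P(1) k2(1) by (intro mult_right_mono) auto
      also have "\<dots> = ?c" using P(1) k2(1) by simp
      finally show ?thesis by (simp only: P_def)
    qed
  qed
  then show thesis using that[of "\<kappa>1 / \<kappa>2"] k1(1) k2(1) by (simp add: \<phi>_def[abs_def])
qed

section \<open>Small powers and points of the unit cube\<close>

lemma small_powr:
  fixes \<beta> C \<rho>1 :: real
  assumes "0 < \<beta>" "0 < C" "0 < \<rho>1"
  obtains \<rho> where "0 < \<rho>" "\<rho> \<le> \<rho>1" "C * \<rho> powr \<beta> < 1"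
proof
  define \<rho> where "\<rho> = min \<rho>1 ((1 / (2 * C)) powr (1 / \<beta>))"
  show "0 < \<rho>" "\<rho> \<le> \<rho>1" using assms by (auto simp: \<rho>_def)
  have "\<rho> powr \<beta> \<le> ((1 / (2 * C)) powr (1 / \<beta>)) powr \<beta>"
    using assms by (intro powr_mono2) (auto simp: \<rho>_def)
  also have "\<dots> = 1 / (2 * C)" using assms by (simp add: powr_powr)
  finally show "C * \<rho> powr \<beta> < 1" using assms by (simp add: field_simps)
qed

lemma zero_cube: "0 \<in> cbox (- One) (One :: 'a::euclidean_space)" by (simp add: mem_box)

lemma cubeI:
  fixes x :: "'a::euclidean_space"
  shows "(\<And>b. b \<in> Basis \<Longrightarrow> \<bar>x \<bullet> b\<bar> \<le> 1) \<Longrightarrow> x \<in> cbox (- One) One"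
  by (force simp: mem_box abs_le_iff)

definition restrict_to :: "'a::euclidean_space set \<Rightarrow> 'a \<Rightarrow> 'a" where
  "restrict_to J x = (\<Sum>b\<in>J. (x \<bullet> b) *\<^sub>R b)"

lemma restrict_to_inner:
  assumes J: "J \<subseteq> Basis" and b: "b \<in> Basis"
  shows "restrict_to J x \<bullet> b = (if b \<in> J then x \<bullet> b else 0)"
proof -
  have "restrict_to J x \<bullet> b = (\<Sum>c\<in>J. if c = b then x \<bullet> b else 0)"
    unfolding restrict_to_def inner_sum_left using assms by (intro sum.cong) (auto simp: inner_Basis)
  then show ?thesis using finite_subset[OF J finite_Basis] by simp
qed

section \<open>Nondegeneracy\<close>

text \<open>
  A negative initial value would stay negative forever.
\<close>

lemma recursion_bounded_below:
  fixes B :: "nat \<Rightarrow> real" and q N :: real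
  assumes rec: "\<And>j. q * B (Suc j) \<le> N * B j" and "0 \<le> q" "0 < N" and B: "\<exists>j. 0 \<le> B j"
  shows "0 \<le> B 0"
proof (rule ccontr)
  assume "\<not> 0 \<le> B 0"
  have "B j < 0" for j
  proof (induction j)
    case (Suc j)
    then have "q * B (Suc j) < 0"
      using rec[of j] \<open>0 < N\<close> mult_pos_neg[of N "B j"] by linarith
    then show ?case using \<open>0 \<le> q\<close> by (simp add: mult_less_0_iff)
  qed (use \<open>\<not> 0 \<le> B 0\<close> in simp)
  then show False using B by (meson not_le)
qed

text \<open>
  The situation near a relative interior point of $E$ in coordinates: the cube is the image of a
  neighbourhood of the point, $I$ spans the directions of $E$, along which $\phi$ vanishes, and the
  origin lies on the free boundary.
\<close>

locale flat_profile =
  fixes \<phi> :: "'a::euclidean_space \<Rightarrow> real" and D q :: real and I :: "'a set"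
  assumes conv: "convex_on (cbox (- One) One) \<phi>"
    and cont: "continuous_on (cbox (- One) One) \<phi>"
    and nonneg: "\<And>x. x \<in> cbox (- One) One \<Longrightarrow> 0 \<le> \<phi> x"
    and q: "0 \<le> q" "q < DIM('a)"
    and D: "0 < D" "box_estimate D q \<phi>"
    and I: "I \<subseteq> Basis"
    and flat: "\<And>x. x \<in> cbox (- One) One \<Longrightarrow> (\<And>b. b \<in> Basis - I \<Longrightarrow> x \<bullet> b = 0) \<Longrightarrow> \<phi> x = 0"
    and pos_near_0: "\<And>\<delta>. 0 < \<delta> \<Longrightarrow> \<exists>x. norm x < \<delta> \<and> 0 < \<phi> x"
begin

lemma box_estimateD:
  assumes "\<And>b. b \<in> Basis \<Longrightarrow> 0 < r \<bullet> b" "cbox (a - r) (a + r) \<subseteq> cbox (- One) One" "0 < \<phi> a"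
    and "\<And>x. x \<in> cbox (a - r) (a + r) \<Longrightarrow> \<eta> \<bullet> x + \<alpha> \<le> \<phi> x"
    and "\<And>x. x \<in> cbox (a - r) (a + r) \<Longrightarrow> \<phi> x \<le> \<eta> \<bullet> x + \<alpha> + h"
  shows "\<phi> a powr q * D * (\<Prod>b\<in>Basis. r \<bullet> b)\<^sup>2 \<le> 2 * (4 * h) ^ DIM('a)"
proof (rule D(2)[unfolded box_estimate_def, rule_format, of r a \<eta> \<alpha> h])
  fix x assume "x \<in> cbox (a - r) (a + r)"
  then show "0 \<le> \<phi> x - \<eta> \<bullet> x - \<alpha> \<and> \<phi> x - \<eta> \<bullet> x - \<alpha> \<le> h"
    using assms(4,5)[of x] by linarith
qed (use assms in auto)

text \<open>
  Let $m_j$ be the maximum of $\phi$ over the box with half sides $2^{-j} r$ and $P$ the product of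
  the $r \cdot b$.  The box estimate, centred at a maximum point over the box of index $j + 1$, reads
  $m_{j+1}^q D P^2 \le C 4^{jn} m_j^n$.  The exponents balance exactly in the scale-invariant
  quantity $(n-q)\log m_j + nj\log 4 - \log (D P^2)$: up to a constant shift it satisfies
  $q B_{j+1} \le n B_j$.  It tends to infinity because $m_j \ge \phi(a) > 0$, so
  $B_0$ cannot be negative, whatever the size of $\phi(a)$.
\<close>

lemma nondegeneracy:
  obtains C where "0 < C"
    "\<And>a r h. \<lbrakk>\<And>b. b \<in> Basis \<Longrightarrow> 0 < r \<bullet> b; cbox (a - r) (a + r) \<subseteq> cbox (- One) One; 0 < \<phi> a;
       \<And>x. x \<in> cbox (a - r) (a + r) \<Longrightarrow> \<phi> x \<le> h\<rbrakk>
     \<Longrightarrow> (\<Prod>b\<in>Basis. r \<bullet> b)\<^sup>2 \<le> C * h powr (DIM('a) - q)"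
proof -
  define N where "N = real DIM('a)"
  have N: "0 < N" "q < N" using q by (auto simp: N_def)
  define K where "K = ((N - q) * (ln 2 + N * ln 4) + N\<^sup>2 * ln 4) / (N - q)"
  have "(\<Prod>b\<in>Basis. r \<bullet> b)\<^sup>2 \<le> (exp K / D) * h powr (N - q)"
    if r: "\<And>b. b \<in> Basis \<Longrightarrow> 0 < r \<bullet> b" and sub: "cbox (a - r) (a + r) \<subseteq> cbox (- One) One"
      and a: "0 < \<phi> a" and h: "\<And>x. x \<in> cbox (a - r) (a + r) \<Longrightarrow> \<phi> x \<le> h" for a r h
  proof -
    define R where "R j = (1 / 2 ^ j) *\<^sub>R r" for j :: nat
    define X where "X j = cbox (a - R j) (a + R j)" for j
    have R: "0 < R j \<bullet> b" if "b \<in> Basis" for j b using r that by (simp add: R_def)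
    have aX: "a \<in> X j" for j using R by (auto simp: X_def mem_box algebra_simps less_imp_le)
    have X_anti: "X (Suc j) \<subseteq> X j" for j
    proof
      fix y assume y: "y \<in> X (Suc j)"
      show "y \<in> X j" unfolding X_def mem_box
      proof
        fix b :: 'a assume b: "b \<in> Basis"
        have "a \<bullet> b - R (Suc j) \<bullet> b \<le> y \<bullet> b" "y \<bullet> b \<le> a \<bullet> b + R (Suc j) \<bullet> b"
          using y b by (auto simp: X_def mem_box inner_diff_left inner_add_left)
        moreover have "R j \<bullet> b = 2 * (R (Suc j) \<bullet> b)" "0 < R j \<bullet> b" using R[OF b] by (auto simp: R_def)
        ultimately show "(a - R j) \<bullet> b \<le> y \<bullet> b \<and> y \<bullet> b \<le> (a + R j) \<bullet> b"
          unfolding inner_diff_left inner_add_left by linarith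
      qed
    qed
    have X0: "X j \<subseteq> X 0" for j
      by (induction j) (use X_anti in auto)
    have "X 0 \<subseteq> cbox (- One) One" using sub by (simp add: X_def R_def)
    with X0 have X_sub: "X j \<subseteq> cbox (- One) One" for j by blast
    have "\<exists>x\<in>X j. \<forall>y\<in>X j. \<phi> y \<le> \<phi> x" for j
      using aX[of j] continuous_on_subset[OF cont X_sub[of j]]
      by (intro continuous_attains_sup) (auto simp: X_def)
    then obtain x where x: "x j \<in> X j" and max: "\<And>y. y \<in> X j \<Longrightarrow> \<phi> y \<le> \<phi> (x j)" for j
      by metis
    have pos: "0 < \<phi> (x j)" for j using a max[OF aX[of j]] by linarith
    define P where "P = (\<Prod>b\<in>Basis. r \<bullet> b)"
    have P: "P > 0" unfolding P_def using r by (intro prod_pos) auto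
    have step: "\<phi> (x (Suc j)) powr q * D * (P / 2 ^ (Suc j * DIM('a)))\<^sup>2 \<le> 2 * (4 * \<phi> (x j)) ^ DIM('a)" for j
    proof -
      let ?a = "x (Suc j)" and ?r = "R (Suc j)"
      have X': "cbox (?a - ?r) (?a + ?r) \<subseteq> X j"
      proof
        fix y assume y: "y \<in> cbox (?a - ?r) (?a + ?r)"
        show "y \<in> X j" unfolding X_def mem_box
        proof
          fix b :: 'a assume b: "b \<in> Basis"
          have "?a \<bullet> b - ?r \<bullet> b \<le> y \<bullet> b" "y \<bullet> b \<le> ?a \<bullet> b + ?r \<bullet> b"
            using y b by (auto simp: mem_box inner_diff_left inner_add_left)
          moreover have "a \<bullet> b - ?r \<bullet> b \<le> ?a \<bullet> b" "?a \<bullet> b \<le> a \<bullet> b + ?r \<bullet> b"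
            using x[of "Suc j"] b by (auto simp: X_def mem_box inner_diff_left inner_add_left)
          moreover have "R j \<bullet> b = 2 * (?r \<bullet> b)" by (simp add: R_def)
          ultimately show "(a - R j) \<bullet> b \<le> y \<bullet> b \<and> y \<bullet> b \<le> (a + R j) \<bullet> b"
            unfolding inner_diff_left inner_add_left by linarith
        qed
      qed
      have "\<phi> ?a powr q * D * (\<Prod>b\<in>Basis. ?r \<bullet> b)\<^sup>2 \<le> 2 * (4 * \<phi> (x j)) ^ DIM('a)"
        using X' X_sub[of j] R pos max
        by (intro box_estimateD[where \<eta> = 0 and \<alpha> = 0]) (auto intro!: nonneg)
      moreover have "(\<Prod>b\<in>Basis. ?r \<bullet> b) = P / 2 ^ (Suc j * DIM('a))"
        by (simp add: R_def P_def prod_dividef power_mult_distrib power_add power_mult)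
      ultimately show ?thesis by simp
    qed
    \<comment> \<open>K is chosen so that adding it to B turns the affine recursion into q * B (Suc j) \<le> N * B j.\<close>
    define L where "L = ln D + 2 * ln P"
    define l where "l j = ln (\<phi> (x j))" for j
    define B where "B j = (N - q) * l j + N * real j * ln 4 - L + K" for j
    have ln4: "ln 4 = 2 * ln (2::real)" using ln_realpow[of 2 2] by simp
    have log_step: "q * l (Suc j) + L - N * real (Suc j) * ln 4 \<le> ln 2 + N * ln 4 + N * l j" for j
    proof -
      have "ln (\<phi> (x (Suc j)) powr q * D * (P / 2 ^ (Suc j * DIM('a)))\<^sup>2) \<le> ln (2 * (4 * \<phi> (x j)) ^ DIM('a))"
        using step[of j] pos[of j] pos[of "Suc j"] D(1) P
        by (subst ln_le_cancel_iff) (auto intro!: mult_pos_pos simp: less_imp_neq[symmetric])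
      moreover have "ln (\<phi> (x (Suc j)) powr q * D * (P / 2 ^ (Suc j * DIM('a)))\<^sup>2)
          = q * l (Suc j) + L - N * real (Suc j) * ln 4"
        using pos[of "Suc j"] D P
        by (simp add: ln_mult ln_div ln_realpow ln_powr l_def L_def N_def ln4 algebra_simps)
      moreover have "ln (2 * (4 * \<phi> (x j)) ^ DIM('a)) = ln 2 + N * ln 4 + N * l j"
        using pos[of j] by (simp add: ln_mult ln_realpow l_def N_def algebra_simps)
      ultimately show ?thesis by simp
    qed
    have "0 \<le> B 0"
    proof (rule recursion_bounded_below[of q B N])
      fix j
      have "(N - q) * (q * l (Suc j) + L - N * real (Suc j) * ln 4)
          \<le> (N - q) * (ln 2 + N * ln 4 + N * l j)"
        using log_step N by (intro mult_left_mono) auto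
      moreover have "(N - q) * K = (N - q) * (ln 2 + N * ln 4) + N\<^sup>2 * ln 4"
        using N by (simp add: K_def)
      ultimately show "q * B (Suc j) \<le> N * B j"
        by (simp add: B_def algebra_simps power2_eq_square)
    next
      have lower: "l j \<ge> ln (\<phi> a)" for j
        unfolding l_def using a pos max[OF aX] by simp
      define u where "u = (N - q) * ln (\<phi> a) - L + K"
      obtain j :: nat where j: "- u \<le> real j * (N * ln 4)"
        using N reals_Archimedean3[of "N * ln 4"] less_imp_le by fastforce
      have "(N - q) * ln (\<phi> a) \<le> (N - q) * l j" using lower[of j] N by (intro mult_left_mono) auto
      then have "0 \<le> B j" using j by (simp add: B_def u_def algebra_simps)
      then show "\<exists>j. 0 \<le> B j" ..
    qed (use q N in auto)
    then have "ln (D * P\<^sup>2) \<le> ln (exp K * \<phi> (x 0) powr (N - q))"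
      using D P pos[of 0] by (simp add: B_def L_def l_def ln_mult ln_realpow ln_powr algebra_simps)
    then have "D * P\<^sup>2 \<le> exp K * \<phi> (x 0) powr (N - q)"
      using D P pos[of 0] by (subst (asm) ln_le_cancel_iff) auto
    also have "\<dots> \<le> exp K * h powr (N - q)"
      using x[of 0] h pos[of 0] N by (intro mult_left_mono powr_mono2) (auto simp: X_def R_def less_imp_le)
    finally show ?thesis using D by (simp add: P_def field_simps)
  qed
  then show thesis using D by (intro that[of "exp K / D"]) (auto simp: N_def)
qed

section \<open>Growth transverse to a flat piece\<close>

lemma phi_0: "\<phi> 0 = 0" by (intro flat zero_cube) auto

lemma phi_shrink:
  assumes "x \<in> cbox (- One) One" "0 \<le> t" "t \<le> 1"
  shows "\<phi> (t *\<^sub>R x) \<le> t * \<phi> x"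
  using convex_onD[OF conv, of t 0 x] assms zero_cube phi_0 by simp

lemma convex_average2:
  assumes "x \<in> cbox (- One) One" "y \<in> cbox (- One) One" "z = (1/2) *\<^sub>R x + (1/2) *\<^sub>R y"
  shows "\<phi> z \<le> (\<phi> x + \<phi> y) / 2"
  using convex_onD[OF conv, of "1/2" x y] assms by (simp add: field_simps)

lemma convex_average3:
  assumes "x \<in> cbox (- One) One" "y \<in> cbox (- One) One" "z \<in> cbox (- One) One"
    and w: "3 *\<^sub>R w = x + y + z"
  shows "3 * \<phi> w \<le> \<phi> x + \<phi> y + \<phi> z"
proof -
  define u where "u = (1/2) *\<^sub>R y + (1/2) *\<^sub>R z"
  have "convex (cbox (- One) (One :: 'a))" by (rule convex_box)
  then have u: "u \<in> cbox (- One) One" unfolding u_def using assms(2,3) by (intro convexD) auto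
  have "w = (1/3) *\<^sub>R (3 *\<^sub>R w)" by simp
  also have "\<dots> = (1 - 2/3) *\<^sub>R x + (2/3) *\<^sub>R u" unfolding w u_def by (simp add: algebra_simps)
  finally have "\<phi> w \<le> (1 - 2/3) * \<phi> x + (2/3) * \<phi> u"
    using convex_onD[OF conv, of "2/3" x u] assms(1) u by simp
  moreover have "\<phi> u \<le> (\<phi> y + \<phi> z) / 2" using assms(2,3) u_def by (rule convex_average2)
  ultimately show ?thesis by (simp add: field_simps)
qed

text \<open>
  A point of the slab is the midpoint of a point of the flat piece, where $\phi = 0$, and of
  a point in the transverse directions.  Hence the transverse bound controls $\phi$ on a box that
  has a fixed size along the flat piece, and nondegeneracy applies to a slightly smaller box
  centred at a nearby point where $\phi$ is positive.
\<close>

lemma slab_growth: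
  obtains C where "0 < C"
    "\<And>\<rho> h. \<lbrakk>0 < \<rho>; 2 * \<rho> \<le> 1; \<And>x. \<lbrakk>\<And>b. b \<in> I \<Longrightarrow> x \<bullet> b = 0; \<And>b. b \<in> Basis \<Longrightarrow> \<bar>x \<bullet> b\<bar> \<le> 2 * \<rho>\<rbrakk> \<Longrightarrow> \<phi> x \<le> h\<rbrakk>
     \<Longrightarrow> \<rho> ^ (2 * card (Basis - I)) \<le> C * h powr (DIM('a) - q)"
proof -
  obtain C where C: "0 < C"
    "\<And>a r h. \<lbrakk>\<And>b. b \<in> Basis \<Longrightarrow> 0 < r \<bullet> b; cbox (a - r) (a + r) \<subseteq> cbox (- One) One; 0 < \<phi> a;
       \<And>x. x \<in> cbox (a - r) (a + r) \<Longrightarrow> \<phi> x \<le> h\<rbrakk>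
     \<Longrightarrow> (\<Prod>b\<in>Basis. r \<bullet> b)\<^sup>2 \<le> C * h powr (DIM('a) - q)"
    using nondegeneracy by blast
  define m where "m = card (Basis - I)"
  define k where "k = card I"
  have "\<rho> ^ (2 * m) \<le> (C * 4 ^ (2 * k) * 2 ^ (2 * m)) * h powr (DIM('a) - q)"
    if \<rho>: "0 < \<rho>" "2 * \<rho> \<le> 1"
      and h: "\<And>x. \<lbrakk>\<And>b. b \<in> I \<Longrightarrow> x \<bullet> b = 0; \<And>b. b \<in> Basis \<Longrightarrow> \<bar>x \<bullet> b\<bar> \<le> 2 * \<rho>\<rbrakk> \<Longrightarrow> \<phi> x \<le> h" for \<rho> h
  proof -
    define r where "r = (\<Sum>b\<in>Basis. (if b \<in> I then 1/4 else \<rho>/2) *\<^sub>R b)"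
    have rb: "r \<bullet> b = (if b \<in> I then 1/4 else \<rho>/2)" if "b \<in> Basis" for b using that by (simp add: r_def)
    obtain a where a: "norm a < \<rho> / 2" "0 < \<phi> a" using pos_near_0[of "\<rho> / 2"] \<rho> by auto
    have ab: "\<bar>a \<bullet> b\<bar> \<le> r \<bullet> b" if "b \<in> Basis" for b
      using Basis_le_norm[OF that, of a] a \<rho> rb[OF that] by auto
    have bnd: "\<bar>x \<bullet> b\<bar> \<le> 2 * (r \<bullet> b)" if "x \<in> cbox (a - r) (a + r)" "b \<in> Basis" for x b
    proof -
      have "a \<bullet> b - r \<bullet> b \<le> x \<bullet> b" "x \<bullet> b \<le> a \<bullet> b + r \<bullet> b"
        using that by (auto simp: mem_box inner_diff_left inner_add_left)
      then show ?thesis using ab[OF that(2)] by linarith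
    qed
    have phi: "\<phi> x \<le> h" if x: "x \<in> cbox (a - r) (a + r)" for x
    proof -
      define y z where "y = 2 *\<^sub>R restrict_to I x" and "z = 2 *\<^sub>R restrict_to (Basis - I) x"
      have yb: "y \<bullet> b = (if b \<in> I then 2 * (x \<bullet> b) else 0)" if "b \<in> Basis" for b
        using I that by (simp add: y_def restrict_to_inner)
      have zb: "z \<bullet> b = (if b \<in> I then 0 else 2 * (x \<bullet> b))" if "b \<in> Basis" for b
        using I that by (simp add: z_def restrict_to_inner)
      have ycube: "\<bar>y \<bullet> b\<bar> \<le> 1" if "b \<in> Basis" for b
        using bnd[OF x that] yb[OF that] rb[OF that] by auto
      have zcube: "\<bar>z \<bullet> b\<bar> \<le> 2 * \<rho>" if "b \<in> Basis" for b
        using bnd[OF x that] zb[OF that] rb[OF that] \<rho> by auto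
      have y: "y \<in> cbox (- One) One" using ycube by (rule cubeI)
      have z: "z \<in> cbox (- One) One" using zcube \<rho>(2) by (intro cubeI) (rule order_trans)
      have "x = (1/2) *\<^sub>R y + (1/2) *\<^sub>R z"
        by (rule euclidean_eqI) (simp add: inner_add_left yb zb)
      then have "\<phi> x \<le> (\<phi> y + \<phi> z) / 2" by (intro convex_average2 y z)
      moreover have "\<phi> y = 0" using y yb by (intro flat) auto
      moreover have "\<phi> z \<le> h" using I zb zcube by (intro h) auto
      moreover have "0 \<le> \<phi> z" using nonneg z by blast
      ultimately show "\<phi> x \<le> h" by argo
    qed
    have "cbox (a - r) (a + r) \<subseteq> cbox (- One) One"
    proof
      fix x assume x: "x \<in> cbox (a - r) (a + r)"
      have "\<bar>x \<bullet> b\<bar> \<le> 1" if "b \<in> Basis" for b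
        using bnd[OF x that] rb[OF that] \<rho> by (auto split: if_splits)
      then show "x \<in> cbox (- One) One" by (rule cubeI)
    qed
    then have "(\<Prod>b\<in>Basis. r \<bullet> b)\<^sup>2 \<le> C * h powr (DIM('a) - q)"
      using a rb \<rho> phi by (intro C(2)) auto
    moreover have "(\<Prod>b\<in>Basis. r \<bullet> b) = (1/4) ^ k * (\<rho>/2) ^ m"
    proof -
      have "(\<Prod>b\<in>Basis. r \<bullet> b) = (\<Prod>b\<in>Basis. if b \<in> I then 1/4 else \<rho>/2)"
        by (intro prod.cong) (auto simp: rb)
      also have "\<dots> = (\<Prod>b\<in>Basis \<inter> I. 1/4) * (\<Prod>b\<in>Basis \<inter> - I. \<rho>/2)"
        by (subst prod.If_cases) auto
      finally show ?thesis using I by (simp add: k_def m_def Int_absorb1 Diff_eq)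
    qed
    ultimately have "((1/4) ^ k * (\<rho>/2) ^ m)\<^sup>2 \<le> C * h powr (DIM('a) - q)" by simp
    moreover have "((1/4) ^ k * (\<rho>/2) ^ m)\<^sup>2 * (4 ^ (2 * k) * 2 ^ (2 * m)) = \<rho> ^ (2 * m)"
      by (simp add: power_mult_distrib power_divide power_mult[symmetric] mult.commute)
    ultimately show ?thesis
      using mult_right_mono[of "((1/4) ^ k * (\<rho>/2) ^ m)\<^sup>2" "C * h powr (DIM('a) - q)" "4 ^ (2 * k) * 2 ^ (2 * m)"]
      by (simp add: ac_simps)
  qed
  then show thesis using C(1) by (intro that[of "C * 4 ^ (2 * k) * 2 ^ (2 * m)"]) (auto simp: m_def)
qed

text \<open>
  If $2m < (n-q)s$, the slab estimate with $h = C\rho^s$ fails for small $\rho$.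
\<close>

theorem codim_ge_growth:
  assumes growth: "\<And>x. x \<in> cbox (- One) One \<Longrightarrow> norm x \<le> \<rho>0 \<Longrightarrow> \<phi> x \<le> C * norm x powr s"
    and "0 < \<rho>0" "0 < C" "0 < s"
  shows "(DIM('a) - q) * s \<le> 2 * real (card (Basis - I))"
proof (rule ccontr)
  assume neg: "\<not> ?thesis"
  define N where "N = real DIM('a)"
  define m where "m = card (Basis - I)"
  have N: "1 \<le> N" "q < N" using q DIM_positive[where 'a='a] by (auto simp: N_def Suc_le_eq)
  obtain C1 where C1: "0 < C1"
    "\<And>\<rho> h. \<lbrakk>0 < \<rho>; 2 * \<rho> \<le> 1; \<And>x. \<lbrakk>\<And>b. b \<in> I \<Longrightarrow> x \<bullet> b = 0; \<And>b. b \<in> Basis \<Longrightarrow> \<bar>x \<bullet> b\<bar> \<le> 2 * \<rho>\<rbrakk> \<Longrightarrow> \<phi> x \<le> h\<rbrakk>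
     \<Longrightarrow> \<rho> ^ (2 * m) \<le> C1 * h powr (N - q)"
    using slab_growth unfolding m_def N_def by blast
  define \<beta> where "\<beta> = (N - q) * s - 2 * real m"
  have \<beta>: "0 < \<beta>" using neg by (simp add: \<beta>_def N_def m_def)
  define C2 where "C2 = C1 * (C * (2 * N) powr s) powr (N - q)"
  have C2: "0 < C2" using C1 N assms by (simp add: C2_def)
  obtain \<rho> where \<rho>: "0 < \<rho>" "\<rho> \<le> min (1/2) (\<rho>0 / (2 * N))" "C2 * \<rho> powr \<beta> < 1"
    using small_powr[OF \<beta> C2, of "min (1/2) (\<rho>0 / (2 * N))"] assms N by auto
  have r2: "2 * \<rho> \<le> 1" using \<rho>(2) by simp
  have rho_N: "2 * \<rho> * N \<le> \<rho>0" using \<rho>(2) N by (simp add: field_simps)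
  have "\<rho> ^ (2 * m) \<le> C1 * (C * (2 * \<rho> * N) powr s) powr (N - q)"
  proof (rule C1(2))
    fix x :: 'a assume x: "\<And>b. b \<in> Basis \<Longrightarrow> \<bar>x \<bullet> b\<bar> \<le> 2 * \<rho>"
    have "norm x \<le> (\<Sum>b\<in>Basis. \<bar>x \<bullet> b\<bar>)" by (rule norm_le_l1)
    also have "\<dots> \<le> (\<Sum>b\<in>(Basis :: 'a set). 2 * \<rho>)" by (intro sum_mono x)
    finally have nx: "norm x \<le> 2 * \<rho> * N" by (simp add: N_def mult.commute)
    have "\<phi> x \<le> C * norm x powr s"
    proof (rule growth)
      show "x \<in> cbox (- One) One" using order_trans[OF x r2] by (intro cubeI)
    qed (use nx rho_N in linarith)
    also have "\<dots> \<le> C * (2 * \<rho> * N) powr s"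
      using nx assms by (intro mult_left_mono powr_mono2) auto
    finally show "\<phi> x \<le> C * (2 * \<rho> * N) powr s" .
  qed (use \<rho> in auto)
  also have "\<dots> = C2 * \<rho> powr ((N - q) * s)"
    using \<rho> N assms by (simp add: C2_def powr_mult powr_powr mult_ac)
  also have "\<dots> = (C2 * \<rho> powr \<beta>) * \<rho> powr (2 * real m)"
    using \<rho>(1) by (simp add: \<beta>_def powr_diff)
  also have "\<dots> < 1 * \<rho> powr (2 * real m)"
    using \<rho> by (intro mult_strict_right_mono) auto
  also have "\<dots> = \<rho> ^ (2 * m)" using \<rho> by (simp add: powr_realpow[symmetric])
  finally show False by simp
qed

section \<open>The strict inequality\<close>

text \<open>
  A convex function that is small along all coordinate axes is small on the cube they span: a point is the
  average of $n$ axis points.  So $\phi \le e\rho$ on a transverse cube, with $e$ as small as desired, and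
  the slab estimate fails.
\<close>

lemma sublinear_direction_impossible:
  assumes m: "2 * real (card (Basis - I)) \<le> DIM('a) - q"
    and sub: "\<And>b \<sigma> \<epsilon>. b \<in> Basis - I \<Longrightarrow> \<bar>\<sigma>\<bar> = 1 \<Longrightarrow> 0 < \<epsilon> \<Longrightarrow>
                 \<exists>t>0. t \<le> 1 \<and> \<phi> ((t * \<sigma>) *\<^sub>R b) \<le> \<epsilon> * t"
  shows False
proof -
  define N where "N = real DIM('a)"
  define m where "m = card (Basis - I)"
  have N: "1 \<le> N" "0 < N - q" using q DIM_positive[where 'a='a] by (auto simp: N_def Suc_le_eq)
  obtain C where C: "0 < C"
    "\<And>\<rho> h. \<lbrakk>0 < \<rho>; 2 * \<rho> \<le> 1; \<And>x. \<lbrakk>\<And>b. b \<in> I \<Longrightarrow> x \<bullet> b = 0; \<And>b. b \<in> Basis \<Longrightarrow> \<bar>x \<bullet> b\<bar> \<le> 2 * \<rho>\<rbrakk> \<Longrightarrow> \<phi> x \<le> h\<rbrakk>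
     \<Longrightarrow> \<rho> ^ (2 * m) \<le> C * h powr (N - q)"
    using slab_growth unfolding m_def N_def by blast
  obtain e where e: "0 < e" "C * e powr (N - q) < 1"
    using small_powr[OF N(2) C(1), of 1] by auto
  \<comment> \<open>Averaging n axis points costs a factor n in the size of the cube, and its half width is 2 * \<rho>.\<close>
  define \<epsilon> where "\<epsilon> = e / (2 * N)"
  have \<epsilon>: "0 < \<epsilon>" using e N by (simp add: \<epsilon>_def)
  have "\<exists>t>0. t \<le> 1 \<and> (\<forall>\<tau>. \<bar>\<tau>\<bar> \<le> t \<longrightarrow> \<phi> (\<tau> *\<^sub>R b) \<le> \<epsilon> * \<bar>\<tau>\<bar>)" if b: "b \<in> Basis" for b
  proof (cases "b \<in> I")
    case True
    have "\<phi> (\<tau> *\<^sub>R b) = 0" if "\<bar>\<tau>\<bar> \<le> 1" for \<tau>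
      using True that b by (intro flat cubeI) (auto simp: inner_Basis)
    then show ?thesis using \<epsilon> by (intro exI[of _ 1]) auto
  next
    case False
    have "\<exists>t>0. t \<le> 1 \<and> (\<forall>\<tau>. 0 \<le> \<tau> \<and> \<tau> \<le> t \<longrightarrow> \<phi> ((\<tau> * \<sigma>) *\<^sub>R b) \<le> \<epsilon> * \<tau>)" if \<sigma>: "\<bar>\<sigma>\<bar> = 1" for \<sigma>
    proof -
      obtain t where t: "0 < t" "t \<le> 1" "\<phi> ((t * \<sigma>) *\<^sub>R b) \<le> \<epsilon> * t"
        using sub[of b \<sigma> \<epsilon>] False b \<sigma> \<epsilon> by blast
      have "\<phi> ((\<tau> * \<sigma>) *\<^sub>R b) \<le> \<epsilon> * \<tau>" if "0 \<le> \<tau>" "\<tau> \<le> t" for \<tau>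
      proof -
        have "(t * \<sigma>) *\<^sub>R b \<in> cbox (- One) One"
          using t \<sigma> b by (intro cubeI) (auto simp: inner_Basis abs_mult)
        then have "\<phi> ((\<tau> / t) *\<^sub>R ((t * \<sigma>) *\<^sub>R b)) \<le> (\<tau> / t) * \<phi> ((t * \<sigma>) *\<^sub>R b)"
          using t that by (intro phi_shrink) auto
        also have "\<dots> \<le> (\<tau> / t) * (\<epsilon> * t)" using t that by (intro mult_left_mono) auto
        finally show ?thesis using t by (simp add: mult.commute)
      qed
      then show ?thesis using t by blast
    qed
    from this[of 1] this[of "-1"] obtain t1 t2 where
      t: "0 < t1" "t1 \<le> 1" "0 < t2" "t2 \<le> 1"
      "\<And>\<tau>. 0 \<le> \<tau> \<Longrightarrow> \<tau> \<le> t1 \<Longrightarrow> \<phi> (\<tau> *\<^sub>R b) \<le> \<epsilon> * \<tau>"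
      "\<And>\<tau>. 0 \<le> \<tau> \<Longrightarrow> \<tau> \<le> t2 \<Longrightarrow> \<phi> (- (\<tau> *\<^sub>R b)) \<le> \<epsilon> * \<tau>"
      by auto
    have "\<phi> (\<tau> *\<^sub>R b) \<le> \<epsilon> * \<bar>\<tau>\<bar>" if "\<bar>\<tau>\<bar> \<le> min t1 t2" for \<tau>
      using t(5)[of \<tau>] t(6)[of "- \<tau>"] that by (cases "0 \<le> \<tau>") auto
    then show ?thesis using t(1-4) by (intro exI[of _ "min t1 t2"]) auto
  qed
  then obtain T where T: "\<And>b. b \<in> Basis \<Longrightarrow> 0 < T b \<and> T b \<le> 1 \<and> (\<forall>\<tau>. \<bar>\<tau>\<bar> \<le> T b \<longrightarrow> \<phi> (\<tau> *\<^sub>R b) \<le> \<epsilon> * \<bar>\<tau>\<bar>)"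
    by metis
  define t where "t = Min (T ` Basis)"
  have t_le: "t \<le> T b" if "b \<in> Basis" for b using that by (simp add: t_def)
  have "t \<in> T ` Basis" unfolding t_def by (intro Min_in) auto
  then have t: "0 < t" "t \<le> 1" using T by auto
  define \<rho> where "\<rho> = t / (2 * N)"
  have \<rho>: "0 < \<rho>" "2 * \<rho> \<le> 1" "2 * \<rho> * N = t"
    using t N by (auto simp: \<rho>_def field_simps)
  have "\<rho> ^ (2 * m) \<le> C * (e * \<rho>) powr (N - q)"
  proof (rule C(2))
    fix x :: 'a assume x: "\<And>b. b \<in> Basis \<Longrightarrow> \<bar>x \<bullet> b\<bar> \<le> 2 * \<rho>"
    have Nx: "\<bar>N * (x \<bullet> b)\<bar> \<le> t" if "b \<in> Basis" for b
    proof -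
      have "\<bar>N * (x \<bullet> b)\<bar> = N * \<bar>x \<bullet> b\<bar>" using N by (simp add: abs_mult)
      also have "\<dots> \<le> N * (2 * \<rho>)" using x[OF that] N by (intro mult_left_mono) auto
      also have "\<dots> = t" using \<rho>(3) by (simp only: mult.commute)
      finally show ?thesis .
    qed
    have "x = (\<Sum>b\<in>Basis. (1 / N) *\<^sub>R ((N * (x \<bullet> b)) *\<^sub>R b))"
      using N by (simp add: euclidean_representation)
    then have "\<phi> x = \<phi> (\<Sum>b\<in>Basis. (1 / N) *\<^sub>R ((N * (x \<bullet> b)) *\<^sub>R b))" by (rule arg_cong)
    also have "\<dots> \<le> (\<Sum>b\<in>Basis. (1 / N) * \<phi> ((N * (x \<bullet> b)) *\<^sub>R b))"
    proof (rule convex_on_sum[OF _ _ conv])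
      show "(N * (x \<bullet> b)) *\<^sub>R b \<in> cbox (- One) One" if "b \<in> Basis" for b
        using Nx[OF that] t that by (intro cubeI) (auto simp: inner_Basis)
    qed (use N in \<open>auto simp: N_def\<close>)
    also have "\<dots> \<le> (\<Sum>b\<in>(Basis :: 'a set). (1 / N) * (\<epsilon> * t))"
    proof (intro sum_mono mult_left_mono)
      fix b :: 'a assume b: "b \<in> Basis"
      have "\<phi> ((N * (x \<bullet> b)) *\<^sub>R b) \<le> \<epsilon> * \<bar>N * (x \<bullet> b)\<bar>"
        using T[OF b] Nx[OF b] t_le[OF b] by auto
      also have "\<dots> \<le> \<epsilon> * t" using Nx[OF b] \<epsilon> by (intro mult_left_mono) auto
      finally show "\<phi> ((N * (x \<bullet> b)) *\<^sub>R b) \<le> \<epsilon> * t" .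
    qed (use N in auto)
    also have "\<dots> = \<epsilon> * t" using N by (simp add: N_def)
    also have "\<dots> = e * \<rho>" using N by (simp add: \<epsilon>_def \<rho>_def)
    finally show "\<phi> x \<le> e * \<rho>" .
  qed (use \<rho> in auto)
  also have "\<dots> = (C * e powr (N - q)) * \<rho> powr (N - q)"
    using e \<rho> by (simp add: powr_mult)
  also have "\<dots> < 1 * \<rho> powr (N - q)"
    using e \<rho> by (intro mult_strict_right_mono) auto
  also have "\<dots> \<le> \<rho> powr (real (2 * m))"
    using \<rho> m by (simp add: N_def m_def powr_mono')
  also have "\<dots> = \<rho> ^ (2 * m)" using \<rho> by (subst powr_realpow) auto
  finally show False by simp
qed

text \<open>
  Along the ray in direction $\sigma b_0$ the quotients $\phi/t$ decrease to a limit $a > 0$ as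
  $t \to 0$.  The linear function $\eta$ has slope $a$ along the ray and vanishes in all other
  coordinates.  Writing a point as the average of its suitably dilated components along $I$, along
  the ray and in the remaining directions bounds $\phi - \eta$ from above by
  $O(\epsilon t)$; solving such an average for the point itself bounds it from below.  In the box
  estimate both sides are then of order $t^n$, or the left one is larger, and the powers of
  $\epsilon$ differ by at least $q + 2$.
\<close>

lemma linear_direction_impossible:
  assumes codim: "2 * real (card (Basis - I)) \<le> DIM('a) - q"
    and b0: "b0 \<in> Basis - I" and \<sigma>: "\<bar>\<sigma>\<bar> = 1" and \<epsilon>0: "0 < \<epsilon>0"
    and lin: "\<And>t. 0 < t \<Longrightarrow> t \<le> 1 \<Longrightarrow> \<epsilon>0 * t \<le> \<phi> ((t * \<sigma>) *\<^sub>R b0)"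
  shows False
proof -
  define n where "n = DIM('a)"
  define k where "k = card I"
  define p where "p = card (Basis - I - {b0})"
  have bB: "b0 \<in> Basis" "b0 \<notin> I" using b0 by auto
  have card_eq: "card (Basis - I) = Suc p" unfolding p_def by (rule card.remove[OF _ b0]) auto
  have "2 * real (p + 1) + q \<le> real n" using codim by (simp add: card_eq n_def)
  then have exponent: "real (2 * (p + 1)) + q \<le> real n" "2 * p + 1 \<le> n" using q by auto
  have \<sigma>\<sigma>: "\<sigma> * \<sigma> = 1" using \<sigma> by (auto simp: abs_if split: if_splits)
  define f where "f t = \<phi> ((t * \<sigma>) *\<^sub>R b0)" for t
  have f_cube: "(t * \<sigma>) *\<^sub>R b0 \<in> cbox (- One) One" if "0 \<le> t" "t \<le> 1" for t
    using that \<sigma> bB by (intro cubeI) (auto simp: inner_Basis abs_mult)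
  define a where "a = (INF t\<in>{0<..1}. f t / t)"
  have bdd: "bdd_below ((\<lambda>t. f t / t) ` {0<..1})"
    using lin by (intro bdd_belowI2[of _ \<epsilon>0]) (auto simp: f_def field_simps)
  have "\<epsilon>0 \<le> a" unfolding a_def using lin
    by (intro cINF_greatest) (auto simp: f_def field_simps)
  then have a: "0 < a" using \<epsilon>0 by simp
  have f_ge: "a * t \<le> f t" if "0 < t" "t \<le> 1" for t
    using cINF_lower[OF bdd, of t] that by (simp add: a_def field_simps)
  have f_le: "\<exists>t1>0. t1 \<le> 1 \<and> (\<forall>t. 0 \<le> t \<and> t \<le> t1 \<longrightarrow> f t \<le> (a + \<epsilon>) * t)" if \<epsilon>: "0 < \<epsilon>" for \<epsilon>
  proof -
    have "\<exists>t\<in>{0<..1}. f t / t < a + \<epsilon>"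
      using cINF_less_iff[OF _ bdd, of "a + \<epsilon>"] \<epsilon> by (auto simp: a_def)
    then obtain t1 where t1: "0 < t1" "t1 \<le> 1" "f t1 \<le> (a + \<epsilon>) * t1"
      by (auto simp: divide_less_eq)
    have "f t \<le> (a + \<epsilon>) * t" if "0 \<le> t" "t \<le> t1" for t
    proof -
      have "\<phi> ((t / t1) *\<^sub>R ((t1 * \<sigma>) *\<^sub>R b0)) \<le> (t / t1) * \<phi> ((t1 * \<sigma>) *\<^sub>R b0)"
        using t1 that f_cube[of t1] by (intro phi_shrink) auto
      then have "f t \<le> (t / t1) * f t1" using t1 by (simp add: f_def)
      also have "\<dots> \<le> (t / t1) * ((a + \<epsilon>) * t1)" using t1 that by (intro mult_left_mono) auto
      finally show ?thesis using t1 by (simp add: mult.commute)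
    qed
    then show ?thesis using t1 by blast
  qed
  obtain M where M: "0 \<le> M" "\<And>x. x \<in> cbox (- One) One \<Longrightarrow> \<phi> x \<le> M"
  proof -
    have "cbox (- One) (One :: 'a) \<noteq> {}" using zero_cube by blast
    from continuous_attains_sup[OF compact_cbox this cont] obtain x0 where
      "x0 \<in> cbox (- One) One" "\<forall>y\<in>cbox (- One) One. \<phi> y \<le> \<phi> x0" by blast
    then show ?thesis using that nonneg by blast
  qed
  define c0 where "c0 = a powr q * D * (1/9) ^ k / 4"
  define c1 where "c1 = 2 * (8 * (M + 1)) ^ n"
  have c: "0 < c0" "0 < c1" using a D M by (auto simp: c0_def c1_def)
  have est: "c0 \<le> c1 * \<epsilon>" if \<epsilon>: "0 < \<epsilon>" "\<epsilon> \<le> 1/3" for \<epsilon>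
  proof -
    obtain t1 where t1: "0 < t1" "t1 \<le> 1" "\<And>t. 0 \<le> t \<Longrightarrow> t \<le> t1 \<Longrightarrow> f t \<le> (a + \<epsilon>) * t"
      using f_le[OF \<epsilon>(1)] by blast
    \<comment> \<open>Along the ray the box reaches out to 3t/2, and the average of three dilates
        by 3, so the bound at slope a + \<epsilon> has to hold up to 9t/2; likewise the half side 1/3
        along I keeps the dilate in the cube.\<close>
    define t where "t = 2 * t1 / 9"
    have t: "0 < t" "t \<le> 1" "9 / 2 * t = t1" using t1 by (auto simp: t_def)
    have \<epsilon>t: "0 < \<epsilon> * t" "3 * (\<epsilon> * t) \<le> 1"
      using \<epsilon> t mult_mono[of \<epsilon> "1/3" t 1] by auto
    define c where "c = (t * \<sigma>) *\<^sub>R b0"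
    define r where "r = (\<Sum>b\<in>Basis. (if b \<in> I then 1/3 else if b = b0 then t/2 else \<epsilon> * t) *\<^sub>R b)"
    have rb: "r \<bullet> b = (if b \<in> I then 1/3 else if b = b0 then t/2 else \<epsilon> * t)" if "b \<in> Basis" for b
      using that by (simp add: r_def)
    have cb: "c \<bullet> b = (if b = b0 then t * \<sigma> else 0)" if "b \<in> Basis" for b
      using that bB by (simp add: c_def inner_Basis)
    have near: "\<bar>x \<bullet> b - c \<bullet> b\<bar> \<le> r \<bullet> b" if "x \<in> cbox (c - r) (c + r)" "b \<in> Basis" for x b
    proof -
      have "c \<bullet> b - r \<bullet> b \<le> x \<bullet> b" "x \<bullet> b \<le> c \<bullet> b + r \<bullet> b"
        using that by (auto simp: mem_box inner_diff_left inner_add_left)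
      then show ?thesis by linarith
    qed
    define \<eta> where "\<eta> = (a * \<sigma>) *\<^sub>R b0"
    have key: "x \<in> cbox (- One) One" "\<eta> \<bullet> x - M * (\<epsilon> * t) \<le> \<phi> x"
      "\<phi> x \<le> \<eta> \<bullet> x - M * (\<epsilon> * t) + 2 * (M + 1) * (\<epsilon> * t)" if x: "x \<in> cbox (c - r) (c + r)" for x
    proof -
      define s where "s = \<sigma> * (x \<bullet> b0)"
      have "\<bar>x \<bullet> b0 - t * \<sigma>\<bar> \<le> t / 2" using near[OF x bB(1)] rb[OF bB(1)] cb[OF bB(1)] bB by simp
      then have "\<bar>\<sigma>\<bar> * \<bar>x \<bullet> b0 - t * \<sigma>\<bar> \<le> t / 2" by (simp add: \<sigma>)
      moreover have "\<sigma> * (x \<bullet> b0 - t * \<sigma>) = s - t"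
        by (simp add: s_def right_diff_distrib mult.left_commute[of \<sigma> t] \<sigma>\<sigma>)
      ultimately have "\<bar>s - t\<bar> \<le> t / 2" by (simp only: abs_mult[symmetric])
      then have s: "t / 2 \<le> s" "s \<le> 3 / 2 * t" by linarith+
      then have s': "0 < s" "3 * s \<le> t1" "3 * s \<le> 1" using t t1 by linarith+
      have xs: "x \<bullet> b0 = s * \<sigma>" using \<sigma>\<sigma> by (simp add: s_def mult.commute mult.left_commute)
      define y where "y = restrict_to I x"
      define z where "z = restrict_to (Basis - I - {b0}) x"
      have yb: "y \<bullet> b = (if b \<in> I then x \<bullet> b else 0)" if "b \<in> Basis" for b
        using I that by (simp add: y_def restrict_to_inner)
      have sb: "Basis - I - {b0} \<subseteq> Basis" by auto
      have zb: "z \<bullet> b = (if b \<in> I \<or> b = b0 then 0 else x \<bullet> b)" if "b \<in> Basis" for b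
        using restrict_to_inner[OF sb that, of x] that by (auto simp: z_def)
      have split: "x = y + (s * \<sigma>) *\<^sub>R b0 + z"
        by (rule euclidean_eqI) (use bB in \<open>auto simp: inner_add_left yb zb inner_Basis xs\<close>)
      have y_le: "\<bar>y \<bullet> b\<bar> \<le> 1/3" if "b \<in> Basis" for b
        using near[OF x that] yb[OF that] rb[OF that] cb[OF that] bB by (cases "b = b0") auto
      have z_le: "\<bar>z \<bullet> b\<bar> \<le> \<epsilon> * t" if "b \<in> Basis" for b
        using near[OF x that] zb[OF that] rb[OF that] cb[OF that] \<epsilon>t by auto
      have y_cube: "d *\<^sub>R y \<in> cbox (- One) One" if "\<bar>d\<bar> \<le> 3" for d
        using y_le mult_mono[OF that y_le] by (intro cubeI) (auto simp: abs_mult)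
      have phi_y: "\<phi> (d *\<^sub>R y) = 0" if "\<bar>d\<bar> \<le> 3" for d
        using y_cube[OF that] by (intro flat) (auto simp: yb)
      have z_cube: "d *\<^sub>R z \<in> cbox (- One) One" and phi_z: "\<phi> (d *\<^sub>R z) \<le> \<bar>d\<bar> * (\<epsilon> * t) * M" if d: "\<bar>d\<bar> \<le> 3" for d
      proof -
        define w where "w = (sgn d / (\<epsilon> * t)) *\<^sub>R z"
        have w: "w \<in> cbox (- One) One"
        proof (rule cubeI)
          fix b :: 'a assume "b \<in> Basis"
          then have "\<bar>sgn d\<bar> * \<bar>z \<bullet> b\<bar> \<le> 1 * (\<epsilon> * t)" using z_le by (intro mult_mono) (auto simp: sgn_if)
          then show "\<bar>w \<bullet> b\<bar> \<le> 1" using \<epsilon> t \<epsilon>t by (auto simp: w_def abs_mult divide_le_eq_1_pos split: if_splits)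
        qed
        have dz: "d *\<^sub>R z = (\<bar>d\<bar> * (\<epsilon> * t)) *\<^sub>R w" using \<epsilon>t \<epsilon> t by (simp add: w_def abs_mult_sgn)
        have dt: "\<bar>d\<bar> * (\<epsilon> * t) \<le> 1" "0 \<le> \<bar>d\<bar> * (\<epsilon> * t)"
          using mult_right_mono[OF d, of "\<epsilon> * t"] \<epsilon>t by auto
        show "d *\<^sub>R z \<in> cbox (- One) One"
        proof (rule cubeI)
          fix b :: 'a assume "b \<in> Basis"
          then have "\<bar>w \<bullet> b\<bar> \<le> 1" using w by (force simp: mem_box abs_le_iff)
          then have "(\<bar>d\<bar> * (\<epsilon> * t)) * \<bar>w \<bullet> b\<bar> \<le> 1 * 1" using dt by (intro mult_mono) auto
          then show "\<bar>(d *\<^sub>R z) \<bullet> b\<bar> \<le> 1" unfolding dz using dt \<epsilon> t by (simp add: abs_mult)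
        qed
        have "\<phi> (d *\<^sub>R z) \<le> (\<bar>d\<bar> * (\<epsilon> * t)) * \<phi> w" unfolding dz using w dt by (intro phi_shrink) auto
        also have "\<dots> \<le> (\<bar>d\<bar> * (\<epsilon> * t)) * M" using M(2)[OF w] dt by (intro mult_left_mono) auto
        finally show "\<phi> (d *\<^sub>R z) \<le> \<bar>d\<bar> * (\<epsilon> * t) * M" .
      qed
      show x_cube: "x \<in> cbox (- One) One"
      proof (rule cubeI)
        fix b :: 'a assume b: "b \<in> Basis"
        show "\<bar>x \<bullet> b\<bar> \<le> 1"
          using y_le[OF b] z_le[OF b] yb[OF b] zb[OF b] xs s' \<sigma> \<epsilon>t
          by (cases "b = b0") (auto simp: abs_mult split: if_splits)
      qed
      have \<eta>x: "\<eta> \<bullet> x = a * s" by (simp add: \<eta>_def s_def inner_commute)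
      have "3 * \<phi> x \<le> \<phi> (3 *\<^sub>R y) + \<phi> ((3 * s * \<sigma>) *\<^sub>R b0) + \<phi> (3 *\<^sub>R z)"
        using y_cube[of 3] f_cube[of "3 * s"] z_cube[of 3] s'
        by (intro convex_average3) (auto simp: split scaleR_add_right mult.assoc)
      moreover have "\<phi> ((3 * s * \<sigma>) *\<^sub>R b0) \<le> (a + \<epsilon>) * (3 * s)"
        using t1(3)[of "3 * s"] s' by (simp add: f_def)
      ultimately have "3 * \<phi> x \<le> (a + \<epsilon>) * (3 * s) + 3 * (\<epsilon> * t) * M"
        using phi_y[of 3] phi_z[of 3] by simp
      then have "\<phi> x \<le> a * s + \<epsilon> * s + \<epsilon> * t * M" by (simp add: algebra_simps)
      also have "\<epsilon> * s \<le> 2 * (\<epsilon> * t)" using s mult_left_mono[of s "3/2 * t" \<epsilon>] \<epsilon> \<epsilon>t by simp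
      finally show "\<phi> x \<le> \<eta> \<bullet> x - M * (\<epsilon> * t) + 2 * (M + 1) * (\<epsilon> * t)"
        unfolding \<eta>x by (simp add: algebra_simps)
      have "3 * \<phi> ((s / 3 * \<sigma>) *\<^sub>R b0) \<le> \<phi> x + \<phi> ((-1) *\<^sub>R y) + \<phi> ((-1) *\<^sub>R z)"
        using x_cube y_cube[of "-1"] z_cube[of "-1"]
        by (intro convex_average3) (auto simp: split)
      moreover have "a * (s / 3) \<le> \<phi> ((s / 3 * \<sigma>) *\<^sub>R b0)"
        using f_ge[of "s / 3"] s' by (simp add: f_def)
      ultimately show "\<eta> \<bullet> x - M * (\<epsilon> * t) \<le> \<phi> x"
        unfolding \<eta>x using phi_y[of "-1"] phi_z[of "-1"] by (simp add: mult.commute)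
    qed
    have \<phi>c: "a * t \<le> \<phi> c" using f_ge[of t] t by (simp add: f_def c_def)
    have "\<phi> c powr q * D * (\<Prod>b\<in>Basis. r \<bullet> b)\<^sup>2 \<le> 2 * (4 * (2 * (M + 1) * (\<epsilon> * t))) ^ n"
      unfolding n_def
    proof (rule box_estimateD[where \<eta> = \<eta> and \<alpha> = "- M * (\<epsilon> * t)"])
      show "0 < \<phi> c" using \<phi>c a t mult_pos_pos[of a t] by linarith
      show "0 < r \<bullet> b" if "b \<in> Basis" for b using rb[OF that] \<epsilon>t t by simp
      show "cbox (c - r) (c + r) \<subseteq> cbox (- One) One" using key(1) by blast
      fix x assume x: "x \<in> cbox (c - r) (c + r)"
      show "\<eta> \<bullet> x + - M * (\<epsilon> * t) \<le> \<phi> x" using key(2)[OF x] by simp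
      show "\<phi> x \<le> \<eta> \<bullet> x + - M * (\<epsilon> * t) + 2 * (M + 1) * (\<epsilon> * t)"
        using key(3)[OF x] by simp
    qed
    also have "(\<Prod>b\<in>Basis. r \<bullet> b) = (1/3) ^ k * (t/2 * (\<epsilon> * t) ^ p)"
    proof -
      have "(\<Prod>b\<in>Basis. r \<bullet> b) = (\<Prod>b\<in>I. r \<bullet> b) * ((r \<bullet> b0) * (\<Prod>b\<in>Basis - I - {b0}. r \<bullet> b))"
        using prod.subset_diff[OF I finite_Basis, of "(\<bullet>) r"] prod.remove[OF _ b0, of "(\<bullet>) r"]
        by (simp add: mult.commute)
      also have "(\<Prod>b\<in>I. r \<bullet> b) = (1/3) ^ k"
        using I rb unfolding k_def by (subst prod.cong[OF refl, of I _ "\<lambda>_. 1/3"]) auto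
      also have "(\<Prod>b\<in>Basis - I - {b0}. r \<bullet> b) = (\<epsilon> * t) ^ p"
        using rb unfolding p_def by (subst prod.cong[OF refl, of "Basis - I - {b0}" _ "\<lambda>_. \<epsilon> * t"]) auto
      finally show ?thesis using rb[OF bB(1)] bB(2) by simp
    qed
    also have "\<dots>\<^sup>2 = (1/9) ^ k / 4 * \<epsilon> ^ (2 * p) * t ^ (2 * (p + 1))"
    proof -
      have "((1/3) ^ k)\<^sup>2 = (1/9 :: real) ^ k"
        by (simp only: power_mult[symmetric] mult.commute[of k]) (simp add: power_mult power2_eq_square)
      moreover have "((\<epsilon> * t) ^ p)\<^sup>2 = \<epsilon> ^ (2 * p) * t ^ (2 * p)"
        by (simp only: power_mult[symmetric] mult.commute[of p] power_mult_distrib)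
      ultimately show ?thesis
        by (simp only: power_mult_distrib power_divide) (simp add: power2_eq_square)
    qed
    finally have "\<phi> c powr q * D * ((1/9) ^ k / 4 * \<epsilon> ^ (2 * p) * t ^ (2 * (p + 1))) \<le> c1 * (\<epsilon> ^ n * t ^ n)"
      by (simp add: c1_def power_mult_distrib ac_simps)
    moreover have "c0 * (\<epsilon> ^ (2 * p) * t ^ n) \<le> \<phi> c powr q * D * ((1/9) ^ k / 4 * \<epsilon> ^ (2 * p) * t ^ (2 * (p + 1)))"
    proof -
      have "t ^ n = t powr real n" using t by (simp add: powr_realpow)
      also have "\<dots> \<le> t powr (q + real (2 * (p + 1)))" using t exponent by (intro powr_mono') auto
      also have "\<dots> = t powr q * t ^ (2 * (p + 1))" using t by (simp only: powr_add powr_realpow)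
      finally have tn: "t ^ n \<le> t powr q * t ^ (2 * (p + 1))" .
      have "c0 * (\<epsilon> ^ (2 * p) * t ^ n) \<le> c0 * (\<epsilon> ^ (2 * p) * (t powr q * t ^ (2 * (p + 1))))"
        using c \<epsilon> tn by (intro mult_left_mono) auto
      also have "\<dots> = (a * t) powr q * D * ((1/9) ^ k / 4 * \<epsilon> ^ (2 * p) * t ^ (2 * (p + 1)))"
        using a t by (simp add: c0_def powr_mult)
      also have "\<dots> \<le> \<phi> c powr q * D * ((1/9) ^ k / 4 * \<epsilon> ^ (2 * p) * t ^ (2 * (p + 1)))"
        using \<phi>c a t q D \<epsilon> by (intro mult_right_mono powr_mono2) auto
      finally show ?thesis .
    qed
    ultimately have "c0 * (\<epsilon> ^ (2 * p) * t ^ n) \<le> c1 * (\<epsilon> ^ n * t ^ n)" by linarith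
    then have "(c0 * \<epsilon> ^ (2 * p)) * t ^ n \<le> (c1 * \<epsilon> ^ n) * t ^ n" by (simp only: mult.assoc)
    then have "c0 * \<epsilon> ^ (2 * p) \<le> c1 * \<epsilon> ^ n" using t by simp
    also have "\<dots> \<le> c1 * \<epsilon> ^ (2 * p + 1)"
      using c \<epsilon> exponent by (intro mult_left_mono power_decreasing) auto
    finally have "c0 * \<epsilon> ^ (2 * p) \<le> (c1 * \<epsilon>) * \<epsilon> ^ (2 * p)" by (simp add: mult.assoc)
    then show ?thesis using \<epsilon> by simp
  qed
  define \<epsilon> where "\<epsilon> = min (1/3) (c0 / (2 * c1))"
  have "0 < \<epsilon>" "\<epsilon> \<le> 1/3" using c by (auto simp: \<epsilon>_def)
  then have "c0 \<le> c1 * \<epsilon>" by (rule est)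
  also have "\<dots> \<le> c1 * (c0 / (2 * c1))" using c by (intro mult_left_mono) (auto simp: \<epsilon>_def)
  also have "\<dots> = c0 / 2" using c by simp
  finally show False using c by simp
qed

theorem codim_gt: "DIM('a) - q < 2 * real (card (Basis - I))"
proof (rule ccontr)
  assume "\<not> ?thesis"
  then have codim: "2 * real (card (Basis - I)) \<le> DIM('a) - q" by simp
  show False
  proof (rule sublinear_direction_impossible[OF codim], rule ccontr)
    fix b \<sigma> \<epsilon> assume *: "b \<in> Basis - I" "\<bar>\<sigma>\<bar> = 1" "0 < \<epsilon>"
      "\<not> (\<exists>t>0. t \<le> 1 \<and> \<phi> ((t * \<sigma>) *\<^sub>R b) \<le> \<epsilon> * t)"
    show False
      by (rule linear_direction_impossible[OF codim *(1-3)]) (use *(4) in \<open>auto simp: not_le intro: less_imp_le\<close>)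
  qed
qed

end

section \<open>Coordinates adapted to a face\<close>

text \<open>
  A linear bijection that maps the coordinate directions in $I$ to a basis of the directions of $E$;
  it is scaled down so that the cube stays in $\Omega$ and its flat part in $E$.
\<close>

lemma adapted_frame:
  fixes E :: "'a::euclidean_space set"
  assumes p: "p \<in> rel_interior E" and "E \<subseteq> \<Omega>" "open \<Omega>"
  obtains T :: "'a \<Rightarrow> 'a" and I where "linear T" "bij T" "I \<subseteq> Basis" "int (card I) = aff_dim E"
    "\<And>x. x \<in> cbox (- One) One \<Longrightarrow> p + T x \<in> \<Omega>"
    "\<And>x. x \<in> cbox (- One) One \<Longrightarrow> (\<And>b. b \<in> Basis - I \<Longrightarrow> x \<bullet> b = 0) \<Longrightarrow> p + T x \<in> E"
proof -
  have pE: "p \<in> E" using p rel_interior_subset by blast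
  define V where "V = (+) (- p) ` E"
  obtain B where B: "B \<subseteq> V" "independent B" "V \<subseteq> span B" "card B = dim V"
    using basis_exists by blast
  have pa: "p \<in> affine hull E" using pE by (simp add: hull_inc)
  have dimV: "aff_dim E = int (card B)"
    unfolding B(4) V_def by (rule aff_dim_eq_dim[OF pa])
  have "card B \<le> card (Basis :: 'a set)" using B(4) dim_subset_UNIV[of V] by simp
  then obtain I where I: "I \<subseteq> (Basis :: 'a set)" "card I = card B"
    using obtain_subset_with_card_n by metis
  have finI: "finite I" using I(1) by (rule finite_subset) auto
  have "finite B" using B(2) by (rule independent_imp_finite)
  then obtain h where h: "bij_betw h I B"
    using finI I(2) finite_same_card_bij by blast
  then have "independent (h ` I)" "inj_on h I" using B(2) by (auto simp: bij_betw_def)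
  moreover have "independent I" using I(1) independent_Basis independent_mono by blast
  ultimately obtain g where g: "linear g" "inj g" "\<And>b. b \<in> I \<Longrightarrow> g b = h b"
    using eucl.linear_independent_extend_inj[of I h] by blast
  obtain K where K: "K > 0" "\<And>x. norm (g x) \<le> K * norm x" using linear_bounded_pos[OF g(1)] by blast
  obtain e1 where e1: "e1 > 0" "ball p e1 \<subseteq> \<Omega>" using assms pE open_contains_ball by blast
  obtain e2 where e2: "e2 > 0" "ball p e2 \<inter> affine hull E \<subseteq> E" using p mem_rel_interior_ball by blast
  define N where "N = real DIM('a)"
  have N: "1 \<le> N" using DIM_positive[where 'a='a] by (simp add: N_def Suc_le_eq)
  define \<delta> where "\<delta> = min e1 e2 / (2 * K * N)"
  have \<delta>: "0 < \<delta>" using e1 e2 K N by (simp add: \<delta>_def)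
  define T where "T x = \<delta> *\<^sub>R g x" for x
  have T: "linear T" unfolding T_def[abs_def] using g(1) by (intro linear_compose_scale_right)
  have "inj T" using g(2) \<delta> by (simp add: T_def[abs_def] inj_def)
  then have bijT: "bij T" using linear_injective_imp_surjective[OF T] by (simp add: bij_def)
  have small: "norm (T x) < min e1 e2" if "x \<in> cbox (- One) One" for x
  proof -
    have "norm x \<le> (\<Sum>b\<in>Basis. \<bar>x \<bullet> b\<bar>)" by (rule norm_le_l1)
    also have "\<dots> \<le> (\<Sum>b\<in>(Basis :: 'a set). 1)"
      using that by (intro sum_mono) (auto simp: mem_box abs_le_iff)
    finally have "norm x \<le> N" by (simp add: N_def)
    then have "norm (g x) \<le> K * N" using K by (meson mult_left_mono less_imp_le order_trans)
    then have "norm (T x) \<le> \<delta> * (K * N)" using \<delta> by (simp add: T_def)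
    also have "\<dots> = min e1 e2 / 2" using K N by (simp add: \<delta>_def)
    also have "\<dots> < min e1 e2" using e1 e2 by (simp add: min_def)
    finally show ?thesis .
  qed
  show thesis
  proof
    show "int (card I) = aff_dim E" using dimV I(2) by simp
    show "p + T x \<in> \<Omega>" if "x \<in> cbox (- One) One" for x
      using small[OF that] e1(2) by (auto simp: dist_norm subset_iff)
    show "p + T x \<in> E" if x: "x \<in> cbox (- One) One" and x0: "\<And>b. b \<in> Basis - I \<Longrightarrow> x \<bullet> b = 0" for x
    proof -
      have "x = (\<Sum>b\<in>Basis. (x \<bullet> b) *\<^sub>R b)" by (simp add: euclidean_representation)
      also have "\<dots> = (\<Sum>b\<in>I. (x \<bullet> b) *\<^sub>R b)"
        using I(1) x0 by (intro sum.mono_neutral_right) auto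
      finally have "g x = g (\<Sum>b\<in>I. (x \<bullet> b) *\<^sub>R b)" by (rule arg_cong)
      also have "\<dots> = (\<Sum>b\<in>I. (x \<bullet> b) *\<^sub>R h b)"
        using g(1,3) by (simp add: linear_sum linear_scale)
      also have "\<dots> \<in> span B"
        using h by (intro span_sum span_scale span_base) (auto simp: bij_betw_def)
      finally have "T x \<in> span B" unfolding T_def by (rule span_scale)
      then have "T x \<in> span V" using span_mono[OF B(1)] by blast
      then have "p + T x \<in> affine hull E"
        unfolding affine_hull_span_gen[OF pa] V_def by blast
      moreover have "p + T x \<in> ball p e2" using small[OF x] by (simp add: dist_norm)
      ultimately show ?thesis using e2(2) by blast
    qed
  qed (use T bijT I in auto)
qed

section \<open>Transport of boundary growth\<close>

text \<open>
  Set $p = e + \mu(x_0 - e)$.  The ray from $e$ through $p + z$ passes within distance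
  $|\zeta| = |z|/\mu$ of $x_0$.  Since $\Omega$ contains a ball of radius $r$ about $e$, it contains
  the convex hull of this ball and $x_0$ except for $x_0$ itself, and so the ray cannot leave $\Omega$ noticeably
  before reaching $x_0$; nor can it stay in $\Omega$ noticeably longer, as $x_0$ would then be an
  interior point.  The exit point $x'$ is therefore within $O(|z|)$ of $x_0$, and convexity together
  with $v(e) = 0 \le v(x')$ gives $v(p + z) \le v(x')$.
\<close>

lemma boundary_growth_propagates:
  fixes v :: "'a::euclidean_space \<Rightarrow> real"
  assumes \<Omega>: "convex \<Omega>" "open \<Omega>" and conv: "convex_on (closure \<Omega>) v"
    and nonneg: "\<And>x. x \<in> closure \<Omega> \<Longrightarrow> 0 \<le> v x"
    and e: "e \<in> \<Omega>" "v e = 0" and x0: "x0 \<in> frontier \<Omega>" and \<mu>: "0 < \<mu>" "\<mu> < 1"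
    and C: "0 < C" "0 < s" "\<And>x. x \<in> frontier \<Omega> \<Longrightarrow> v x \<le> C * norm (x - x0) powr s"
  obtains \<rho> C' where "0 < \<rho>" "0 < C'"
    "\<And>z. norm z \<le> \<rho> \<Longrightarrow> v (e + \<mu> *\<^sub>R (x0 - e) + z) \<le> C' * norm z powr s"
proof -
  have fr: "frontier \<Omega> \<subseteq> closure \<Omega>" by (simp add: frontier_def)
  have x0_cl: "x0 \<in> closure \<Omega>" and x0_out: "x0 \<notin> \<Omega>"
    using x0 \<Omega>(2) by (auto simp: frontier_def interior_open)
  have int: "interior \<Omega> = \<Omega>" using \<Omega>(2) by (rule interior_open)
  have e_cl: "e \<in> closure \<Omega>" using e closure_subset by blast
  obtain r where r: "r > 0" "ball e r \<subseteq> \<Omega>" using e \<Omega>(2) open_contains_ball by blast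
  define d where "d = norm (x0 - e)"
  define A where "A = (3 * (d + r) / r + 1) / \<mu>"
  have A: "0 < A" using r \<mu> by (simp add: A_def d_def add_nonneg_pos)
  \<comment> \<open>This radius keeps \<theta> \<le> 1 - \<mu>, so that p + z lies before the exit point.\<close>
  define \<rho> where "\<rho> = \<mu> * r * (1 - \<mu>) / 3"
  have "v (e + \<mu> *\<^sub>R (x0 - e) + z) \<le> C * A powr s * norm z powr s" if z: "norm z \<le> \<rho>" for z
  proof (cases "z = 0")
    case True
    have "e + \<mu> *\<^sub>R (x0 - e) = (1 - \<mu>) *\<^sub>R e + \<mu> *\<^sub>R x0" by (simp add: algebra_simps)
    then have "v (e + \<mu> *\<^sub>R (x0 - e)) \<le> (1 - \<mu>) * v e + \<mu> * v x0"
      using convex_onD[OF conv, of \<mu> e x0] e_cl x0_cl \<mu> by simp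
    also have "v x0 \<le> 0" using C(3)[OF x0] by simp
    finally show ?thesis using True e \<mu> by (simp add: mult_nonneg_nonpos)
  next
    case False
    define \<zeta> where "\<zeta> = (1 / \<mu>) *\<^sub>R z"
    define \<theta> where "\<theta> = 3 * norm \<zeta> / r"
    have \<zeta>: "0 < norm \<zeta>" "norm \<zeta> = norm z / \<mu>" using False \<mu> by (auto simp: \<zeta>_def)
    have \<zeta>\<theta>: "norm \<zeta> = \<theta> * r / 3" using r by (simp add: \<theta>_def)
    have "norm \<zeta> \<le> r * (1 - \<mu>) / 3"
      using z unfolding \<zeta>(2) \<rho>_def pos_divide_le_eq[OF \<mu>(1)] by (simp add: ac_simps)
    then have "\<theta> \<le> 1 - \<mu>"
      unfolding \<theta>_def pos_divide_le_eq[OF r(1)] by (simp add: mult.commute)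
    moreover have "0 < \<theta>" using r \<zeta>(1) by (simp add: \<theta>_def)
    ultimately have \<theta>: "0 < \<theta>" "\<theta> \<le> 1 - \<mu>" "\<theta> < 1" using \<mu> by auto
    define w where "w = x0 - e + \<zeta>"
    \<comment> \<open>The ray parameter of the exit point differs from 1 by at most \<theta>.\<close>
    have y1: "e + (1 - \<theta>) *\<^sub>R w \<in> \<Omega>"
    proof -
      define c where "c = e + ((1 - \<theta>) / \<theta>) *\<^sub>R \<zeta>"
      have "norm (c - e) = ((1 - \<theta>) / \<theta>) * norm \<zeta>" using \<theta> by (simp add: c_def)
      also have "\<dots> \<le> (1 / \<theta>) * norm \<zeta>"
        using \<theta> by (intro mult_right_mono divide_right_mono) auto
      also have "\<dots> < r" using \<theta> r by (simp add: \<zeta>\<theta>)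
      finally have "c \<in> interior \<Omega>" using r(2) int by (auto simp: dist_norm norm_minus_commute subset_iff)
      then have "x0 - \<theta> *\<^sub>R (x0 - c) \<in> interior \<Omega>"
        using mem_interior_closure_convex_shrink[OF \<Omega>(1) _ x0_cl, of c \<theta>] \<theta> by simp
      moreover have "\<theta> *\<^sub>R c = \<theta> *\<^sub>R e + (1 - \<theta>) *\<^sub>R \<zeta>" using \<theta> by (simp add: c_def scaleR_add_right)
      then have "x0 - \<theta> *\<^sub>R (x0 - c) = e + (1 - \<theta>) *\<^sub>R w"
        unfolding scaleR_diff_right by (simp add: w_def algebra_simps)
      ultimately show ?thesis using int by simp
    qed
    have y2: "e + (1 + \<theta>) *\<^sub>R w \<notin> \<Omega>"
    proof
      assume y: "e + (1 + \<theta>) *\<^sub>R w \<in> \<Omega>"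
      define y2 where "y2 = e + (1 + \<theta>) *\<^sub>R w"
      define c where "c = e - ((1 + \<theta>) / \<theta>) *\<^sub>R \<zeta>"
      define l where "l = \<theta> / (1 + \<theta>)"
      have "l * (1 + \<theta>) = \<theta>" using \<theta> by (simp add: l_def)
      then have l4: "(1 - l) * (1 + \<theta>) = 1" by (simp add: left_diff_distrib)
      have l: "0 < l" "l \<le> 1" "l * ((1 + \<theta>) / \<theta>) = 1"
        using \<theta> by (auto simp: l_def)
      have "norm (c - e) = ((1 + \<theta>) / \<theta>) * norm \<zeta>" using \<theta> by (simp add: c_def)
      also have "\<dots> \<le> (2 / \<theta>) * norm \<zeta>"
        using \<theta> by (intro mult_right_mono divide_right_mono) auto
      also have "\<dots> < r" using \<theta> r by (simp add: \<zeta>\<theta>)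
      finally have "c \<in> interior \<Omega>" using r(2) int by (auto simp: dist_norm norm_minus_commute subset_iff)
      then have "y2 - l *\<^sub>R (y2 - c) \<in> interior \<Omega>"
        using mem_interior_closure_convex_shrink[OF \<Omega>(1), of c y2 l] l y closure_subset
        by (auto simp: y2_def)
      moreover have "y2 - l *\<^sub>R (y2 - c) = x0"
      proof -
        have "l *\<^sub>R c = l *\<^sub>R e - \<zeta>" using l(3) by (simp add: c_def scaleR_diff_right)
        moreover have "(1 - l) *\<^sub>R y2 = (1 - l) *\<^sub>R e + w" using l4 by (simp add: y2_def scaleR_add_right)
        moreover have "y2 - l *\<^sub>R (y2 - c) = (1 - l) *\<^sub>R y2 + l *\<^sub>R c" by (simp add: algebra_simps)
        ultimately have "y2 - l *\<^sub>R (y2 - c) = ((1 - l) *\<^sub>R e + w) + (l *\<^sub>R e - \<zeta>)" by (simp only:)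
        then show ?thesis by (simp add: w_def algebra_simps)
      qed
      ultimately show False using x0_out int by simp
    qed
    let ?S = "closed_segment (e + (1 - \<theta>) *\<^sub>R w) (e + (1 + \<theta>) *\<^sub>R w)"
    have "?S \<inter> frontier \<Omega> \<noteq> {}"
      using y1 y2 by (intro connected_Int_frontier) (auto intro: connected_segment)
    then obtain x' where x': "x' \<in> frontier \<Omega>" "x' \<in> ?S" by blast
    then obtain u where u: "0 \<le> u" "u \<le> 1"
      and x'_eq: "x' = (1 - u) *\<^sub>R (e + (1 - \<theta>) *\<^sub>R w) + u *\<^sub>R (e + (1 + \<theta>) *\<^sub>R w)"
      unfolding in_segment by blast
    define \<tau> where "\<tau> = (1 - u) * (1 - \<theta>) + u * (1 + \<theta>)"
    have \<tau>_eq: "\<tau> - 1 = (2 * u - 1) * \<theta>" by (simp add: \<tau>_def algebra_simps)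
    have "x' = ((1 - u) *\<^sub>R e + u *\<^sub>R e) + (((1 - u) * (1 - \<theta>)) *\<^sub>R w + (u * (1 + \<theta>)) *\<^sub>R w)"
      by (simp only: x'_eq scaleR_add_right scaleR_scaleR ac_simps)
    then have x'_\<tau>: "x' = e + \<tau> *\<^sub>R w"
      unfolding scaleR_add_left[symmetric] \<tau>_def by simp
    have "\<bar>2 * u - 1\<bar> * \<theta> \<le> 1 * \<theta>" using u \<theta> by (intro mult_right_mono) auto
    then have \<tau>1: "\<bar>\<tau> - 1\<bar> \<le> \<theta>" using \<theta> by (simp add: \<tau>_eq abs_mult)
    then have \<tau>: "\<mu> \<le> \<tau>" "0 < \<tau>" using \<theta> \<mu> by linarith+
    have "e + \<mu> *\<^sub>R (x0 - e) + z = e + \<mu> *\<^sub>R w" using \<mu> by (simp add: w_def \<zeta>_def scaleR_add_right)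
    also have "\<dots> = (1 - \<mu> / \<tau>) *\<^sub>R e + (\<mu> / \<tau>) *\<^sub>R x'" using \<tau> by (simp add: x'_\<tau> algebra_simps)
    finally have "v (e + \<mu> *\<^sub>R (x0 - e) + z) \<le> (1 - \<mu> / \<tau>) * v e + (\<mu> / \<tau>) * v x'"
      using convex_onD[OF conv, of "\<mu> / \<tau>" e x'] e_cl x' fr \<tau> \<mu> by auto
    also have "\<dots> \<le> v x'" using e nonneg[of x'] x' fr \<tau> \<mu> mult_right_mono[of "\<mu> / \<tau>" 1 "v x'"] by auto
    also have "\<dots> \<le> C * norm (x' - x0) powr s" using C(3) x'(1) .
    also have "\<dots> \<le> C * (A * norm z) powr s"
    proof -
      have "x' - x0 = (\<tau> - 1) *\<^sub>R w + \<zeta>" by (simp add: x'_\<tau> w_def algebra_simps)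
      then have "norm (x' - x0) \<le> \<bar>\<tau> - 1\<bar> * norm w + norm \<zeta>"
        using norm_triangle_ineq[of "(\<tau> - 1) *\<^sub>R w" \<zeta>] by simp
      also have "\<dots> \<le> \<theta> * (d + r) + norm \<zeta>"
      proof -
        have "norm \<zeta> \<le> r" using \<theta> r by (simp add: \<zeta>\<theta>)
        then have "norm w \<le> d + r" using norm_triangle_ineq[of "x0 - e" \<zeta>] by (simp add: w_def d_def)
        then show ?thesis using \<tau>1 \<theta> by (intro add_mono mult_mono) auto
      qed
      also have "\<dots> = A * norm z" using \<mu> r by (simp add: A_def \<theta>_def \<zeta>(2) field_simps)
      finally show ?thesis using C by (intro mult_left_mono powr_mono2) auto
    qed
    also have "\<dots> = C * A powr s * norm z powr s" using A by (simp add: powr_mult)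
    finally show ?thesis .
  qed
  moreover have "0 < \<rho>" using r \<mu> by (simp add: \<rho>_def)
  ultimately show thesis using A C by (intro that[of \<rho> "C * A powr s"]) auto
qed

section \<open>The dimension of flat pieces of the free boundary\<close>

theorem theorem1p1:
  fixes \<Omega> :: "(real ^ 'n) set" and q :: real and v :: "real ^ 'n \<Rightarrow> real"
  assumes "bounded \<Omega>" and "convex \<Omega>" and "open \<Omega>"
    and "0 \<le> q" and "q < real CARD('n)"
    and "continuous_on (closure \<Omega>) v"
    and "\<exists>x\<in>closure \<Omega>. v x \<noteq> 0"
    and "convex_on (closure \<Omega>) v"
    and "\<forall>x\<in>closure \<Omega>. 0 \<le> v x"
    and "aleksandrov_det_ge \<Omega> v (\<lambda>x. v x powr q * indicator {x. v x > 0} x)"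
  shows "\<forall>E. convex E \<and> E \<subseteq> free_boundary_nsc \<Omega> v \<longrightarrow>
           real_of_int (aff_dim E) < (real CARD('n) + q) / 2 \<and>
           (\<forall>x\<^sub>0 C s. x\<^sub>0 \<in> closure E \<inter> frontier \<Omega> \<and> C > 1 \<and> s > 1 \<and>
                (\<forall>x\<in>frontier \<Omega>. v x \<le> C * norm (x - x\<^sub>0) powr s) \<longrightarrow>
              real_of_int (aff_dim E) \<le> real CARD('n) - (real CARD('n) - q) * s / 2)"
proof (intro allI impI)
  fix E assume E: "convex E \<and> E \<subseteq> free_boundary_nsc \<Omega> v"
  show "real_of_int (aff_dim E) < (real CARD('n) + q) / 2 \<and>
           (\<forall>x\<^sub>0 C s. x\<^sub>0 \<in> closure E \<inter> frontier \<Omega> \<and> C > 1 \<and> s > 1 \<and>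
                (\<forall>x\<in>frontier \<Omega>. v x \<le> C * norm (x - x\<^sub>0) powr s) \<longrightarrow>
              real_of_int (aff_dim E) \<le> real CARD('n) - (real CARD('n) - q) * s / 2)"
  proof (cases "E = {}")
    case True
    then show ?thesis using assms(4) by (simp add: add_pos_nonneg)
  next
    case False
    have cl: "\<Omega> \<subseteq> closure \<Omega>" by (rule closure_subset)
    have E_\<Omega>: "E \<subseteq> \<Omega>" and E_fr: "E \<subseteq> frontier (coincidence_set \<Omega> v)"
      using E by (auto simp: free_boundary_nsc_def free_boundary_def)
    have "closure (coincidence_set \<Omega> v) \<subseteq> {x \<in> closure \<Omega>. v x = 0}"
      using cl by (intro closure_minimal continuous_closed_preimage_constant assms(6))
        (auto simp: coincidence_set_def)
    then have v0: "v x = 0" if "x \<in> E" for x using that E_fr by (auto simp: frontier_def)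
    have "rel_interior E \<noteq> {}" using False E by (simp add: rel_interior_eq_empty)
    then obtain p where p: "p \<in> rel_interior E" by blast
    then have pE: "p \<in> E" using rel_interior_subset by blast
    obtain T :: "real ^ 'n \<Rightarrow> real ^ 'n" and I where T: "linear T" "bij T"
      and dir: "I \<subseteq> Basis" "int (card I) = aff_dim E"
      and T\<Omega>: "\<And>x. x \<in> cbox (- One) One \<Longrightarrow> p + T x \<in> \<Omega>"
      and TE: "\<And>x. x \<in> cbox (- One) One \<Longrightarrow> (\<And>b. b \<in> Basis - I \<Longrightarrow> x \<bullet> b = 0) \<Longrightarrow> p + T x \<in> E"
      using adapted_frame[OF p E_\<Omega> assms(3)] by blast
    have cont: "continuous_on \<Omega> v" and conv: "convex_on \<Omega> v"
      using assms(2,6,8) cl continuous_on_subset convex_on_subset by blast+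
    obtain D where D: "0 < D" "box_estimate D q (\<lambda>x. v (p + T x))"
      using aleksandrov_box_estimate[OF assms(10,4) cont conv T T\<Omega>] by blast
    have linv: "linear (inv T)"
      using T by (simp add: bij_def inj_linear_imp_inv_linear)
    interpret flat_profile "\<lambda>x. v (p + T x)" D q I
    proof
      show "convex_on (cbox (- One) One) (\<lambda>x. v (p + T x))"
        using T\<Omega> by (intro convex_on_affine_precompose[OF conv T(1)]) (auto intro: convex_box)
      show "continuous_on (cbox (- One) One) (\<lambda>x. v (p + T x))"
        using T\<Omega> T(1) by (intro continuous_on_compose2[OF cont] continuous_on_add continuous_on_const
            linear_continuous_on) (auto simp: linear_conv_bounded_linear)
      show "0 \<le> v (p + T x)" if "x \<in> cbox (- One) One" for x
        using assms(9) T\<Omega>[OF that] cl by blast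
      show "v (p + T x) = 0" if "x \<in> cbox (- One) One" "\<And>b. b \<in> Basis - I \<Longrightarrow> x \<bullet> b = 0" for x
        using v0 TE that by blast
      show "\<exists>x. norm x < \<delta> \<and> 0 < v (p + T x)" if \<delta>: "0 < \<delta>" for \<delta>
      proof -
        obtain K where K: "K > 0" "\<And>x. norm (inv T x) \<le> K * norm x" using linear_bounded_pos[OF linv] by blast
        obtain r where r: "r > 0" "ball p r \<subseteq> \<Omega>" using pE E_\<Omega> assms(3) open_contains_ball by blast
        have "p \<notin> interior (coincidence_set \<Omega> v)" using pE E_fr by (auto simp: frontier_def)
        then have "\<not> ball p (min r (\<delta> / K)) \<subseteq> coincidence_set \<Omega> v"
          using r K \<delta> by (auto simp: mem_interior)
        then obtain y where y: "dist p y < min r (\<delta> / K)" "y \<notin> coincidence_set \<Omega> v"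
          by (auto simp: subset_iff)
        then have "y \<in> \<Omega>" using r(2) by auto
        then have "v y \<noteq> 0" "0 \<le> v y" using y(2) assms(9) cl by (auto simp: coincidence_set_def)
        moreover have "norm (inv T (y - p)) < \<delta>"
        proof -
          have "norm (inv T (y - p)) \<le> K * norm (y - p)" by (rule K(2))
          also have "\<dots> < \<delta>" using y(1) K(1) by (simp add: dist_norm norm_minus_commute field_simps)
          finally show ?thesis .
        qed
        ultimately show ?thesis using T(2)
          by (intro exI[of _ "inv T (y - p)"]) (simp add: bij_def surj_f_inv_f)
      qed
    qed (use assms(4,5) D dir in auto)
    have "card I \<le> CARD('n)" using card_mono[OF finite_Basis dir(1)] by simp
    moreover have "card (Basis - I) = CARD('n) - card I"
      using dir(1) by (simp add: card_Diff_subset finite_subset[OF dir(1)])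
    moreover have dimE: "real_of_int (aff_dim E) = real (card I)" using dir(2) by (metis of_int_of_nat_eq)
    ultimately have codim: "real (card (Basis - I)) = real CARD('n) - real_of_int (aff_dim E)"
      by simp
    show ?thesis
    proof (intro conjI allI impI)
      show "real_of_int (aff_dim E) < (real CARD('n) + q) / 2"
        using codim_gt codim by simp
      fix x0 C s
      assume *: "x0 \<in> closure E \<inter> frontier \<Omega> \<and> C > 1 \<and> s > 1 \<and>
                (\<forall>x\<in>frontier \<Omega>. v x \<le> C * norm (x - x0) powr s)"
      \<comment> \<open>Since p is a relative interior point, the segment from x0 to p extends beyond p inside E.\<close>
      have "x0 \<in> affine hull E"
        using * closure_minimal[OF hull_subset closed_affine_hull] by blast
      then obtain m where m: "m > 1" "(1 - m) *\<^sub>R x0 + m *\<^sub>R p \<in> E"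
        using convex_rel_interior_if2[OF _ p] E by blast
      define e where "e = (1 - m) *\<^sub>R x0 + m *\<^sub>R p"
      define \<mu> where "\<mu> = (m - 1) / m"
      have \<mu>: "0 < \<mu>" "\<mu> < 1" using m by (auto simp: \<mu>_def)
      have "(1 - \<mu>) * m = 1" "(1 - \<mu>) * (1 - m) = - \<mu>" using m by (auto simp: \<mu>_def field_simps)
      then have "(1 - \<mu>) *\<^sub>R e = p - \<mu> *\<^sub>R x0" by (simp add: e_def scaleR_add_right)
      then have p_eq: "e + \<mu> *\<^sub>R (x0 - e) = p" by (simp add: algebra_simps)
      have eE: "e \<in> E" using m(2) by (simp add: e_def)
      obtain \<rho> C' where \<rho>: "0 < \<rho>" "0 < C'" "\<And>z. norm z \<le> \<rho> \<Longrightarrow> v (p + z) \<le> C' * norm z powr s"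
      proof (rule boundary_growth_propagates[OF assms(2,3,8), of e x0 \<mu> C s])
        show "e \<in> \<Omega>" "v e = 0" using eE v0 E_\<Omega> by auto
      qed (use that assms(9) * \<mu> in \<open>auto simp: p_eq\<close>)
      obtain K where K: "K > 0" "\<And>x. norm (T x) \<le> K * norm x" using linear_bounded_pos[OF T(1)] by blast
      have "(DIM(real ^ 'n) - q) * s \<le> 2 * real (card (Basis - I))"
      proof (rule codim_ge_growth)
        fix x :: "real ^ 'n" assume x: "norm x \<le> \<rho> / K"
        have "norm (T x) \<le> \<rho>" using K(2)[of x] x K(1) by (simp add: field_simps)
        then have "v (p + T x) \<le> C' * norm (T x) powr s" by (rule \<rho>(3))
        also have "\<dots> \<le> C' * (K * norm x) powr s"
          using K * \<rho> by (intro mult_left_mono powr_mono2) auto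
        finally show "v (p + T x) \<le> C' * K powr s * norm x powr s" using K by (simp add: powr_mult)
      qed (use K \<rho> * in auto)
      then show "real_of_int (aff_dim E) \<le> real CARD('n) - (real CARD('n) - q) * s / 2"
        using codim by simp
    qed
  qed
qed

end
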